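(* Let $\mathcal A$ be a commutative semiring, $n\ge 2$, $V_n$ the free $\mathcal A$-module with basis $b_0,\dots,b_{n-1}$, $f\in\operatorname{End}_{\mathcal A}(V_n)$, $D(z)$ the Hasse–Schmidt derivation on $\bigwedge V_n$ associated with $f$, and $\overline D(z)$ its quasi-inverse (all as described in the context). Then for all $u,v\in\bigwedge^{>0}V_n=\bigoplus_{r\ge1}\bigwedge^rV_n$, $$\overline D(z)\bigl(D(z)u\wedge v\bigr)\ \succeq\ u\wedge \overline D(z)v .$$
   Context: Grassmann semialgebra. $\bigwedge V_n=\bigoplus_{r\ge0}\bigwedge^rV_n$ is the graded associative $\mathcal A$-semialgebra with product $\wedge$ such that $\bigwedge^0V_n=\mathcal A$, $\bigwedge^1V_n=V_n$, and for $r\ge2$, $\bigwedge^rV_n$ is the free $\mathcal A$-module with basis $\{b_I,b_I': I\subseteq\{0,\dots,n-1\},|I|=r\}$ (rank $2\binom nr$; zero if $r>n$), where $b_I=b_{i_1}\wedge\cdots\wedge b_{i_r}$ for $I=\{i_1<\dots<i_r\}$. On each $\bigwedge^rV_n$, $r\ge2$, the negation map $(-)$ is the $\mathcal A$-linear involution exchanging $b_I$ and $b_I'$; it is compatible with $\wedge$ ($((-)x)\wedge y=x\wedge((-)y)=(-)(x\wedge y)$ in degrees $\ge2$), $b_i\wedge b_i=\mathbb 0$, and $u\wedge w=(-)(w\wedge u)$ for $u,w\in V_n$. Hence a product $b_{j_1}\wedge\cdots\wedge b_{j_r}$ is $\mathbb 0$ if two indices coincide, and otherwise equals $b_I$ or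 $b_I'=(-)b_I$ according as the permutation sorting $(j_1,\dots,j_r)$ increasingly is even or odd. Write $x(-)y:=x+((-)y)$ and $(-)^j$ for the $j$-fold application of $(-)$. A quasi-zero is an element $x(-)x$. For $x,y$ of the same degree $\ge2$, $x\succeq y$ means $x=y+d$ with $d$ in the ideal generated by the quasi-zeros and all $w\wedge w$, $w\in V_n$; for power series in $z$ with such coefficients, $\succeq$ is meant coefficientwise. Hasse–Schmidt derivation. $D(z)=\sum_{i\ge0}D_iz^i$ with $D_i\in\operatorname{End}_{\mathcal A}(\bigwedge V_n)$ preserving each $\bigwedge^rV_n$, $D(z)(u\wedge v)=D(z)u\wedge D(z)v$ (i.e. $D_k(u\wedge v)=\sum_{i+j=k}D_iu\wedge D_jv$), and $D_iv=f^i(v)$ for $v\in V_n$; thus $D(z)(u_1\wedge\cdots\wedge u_r)=D(z)u_1\wedge\cdots\wedge D(z)u_r$ with $D(z)u_k=\sum_i f^i(u_k)z^i$, and $D_1=f$ on $V_n$. Operators act on power series in $z$ coefficientwise. Quasi-inverse. For $r\ge2$ and $u_1,\dots,u_r\in V_n$, $\overline D(z)(u_1\wedge\cdots\wedge u_r)=\sum_{j=0}^r z^j\,(-)^j\sum_{S\subseteq\{1,\dots,r\},|S|=j}u_1^S\wedge\cdots\wedge u_r^S$, where $u_k^S=f(u_k)$ if $k\in S$ and $u_k^S=u_k$ otherwise, extended additively; e.g. $\overline D(z)(u\wedge v)=u\wedge v+(f(v)\wedge u+v\wedge f(u))z+(f(u)\wedge f(v))z^2$. Write $\overline D(z)=\sum_j\overline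 D_jz^j$. For $u\in\bigwedge^{\ge1}V_n$ and $v=v_1\wedge\cdots\wedge v_s$ ($s\ge1$, $v_k\in V_n$), $u\wedge\overline D(z)v:=\sum_{j}z^j(-)^j\sum_{|S|=j}u\wedge v_1^S\wedge\cdots\wedge v_s^S$ (for $s\ge2$ this is $u\wedge(\overline D(z)v)$; for $s=1$ it is $u\wedge v+z\,(-)(u\wedge f(v))$), extended additively in $v$.
   Formalization: D(z) and its quasi-inverse are taken as the linear maps given by their formulas on the basis elements b_I, b_I' only; demanding the formulas for all products is inconsistent (b_0∧b_0=0, yet with f(b_0)=b_1 the rule gives D_1(b_0∧b_0)=b_I+b_I'≠0). *)

theory Defs
  imports Main "HOL-Library.Function_Algebras"
begin

text \<open>An element of the Grassmann semialgebra is represented by its coefficient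
function on basis keys.  A key (I, p) with I a finite set of indices stands for
b_I (p = False) or b_I' (p = True).  Degree 0 is the key ({}, False) (the unit),
degree 1 the keys ({i}, False) = b_i; primed keys only exist for card I \<ge> 2.\<close>

type_synonym 'a ext = "nat set \<times> bool \<Rightarrow> 'a"
type_synonym 'a vect = "nat \<Rightarrow> 'a"

definition gkeys :: "nat \<Rightarrow> (nat set \<times> bool) set" where
  "gkeys n = {(I, p). I \<subseteq> {..<n} \<and> (p \<longrightarrow> 2 \<le> card I)}"

definition gwf :: "nat \<Rightarrow> 'a::zero ext \<Rightarrow> bool" where
  "gwf n x \<longleftrightarrow> (\<forall>K. K \<notin> gkeys n \<longrightarrow> x K = 0)"

definition vin :: "nat \<Rightarrow> 'a::zero vect \<Rightarrow> bool" where
  "vin n v \<longleftrightarrow> (\<forall>i\<ge>n. v i = 0)"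

definition bv :: "nat \<Rightarrow> 'a::{zero,one} vect" where
  "bv i = (\<lambda>j. if j = i then 1 else 0)"

definition endo :: "nat \<Rightarrow> ('a::comm_semiring_1 vect \<Rightarrow> 'a vect) \<Rightarrow> bool" where
  "endo n f \<longleftrightarrow> (\<forall>v. vin n v \<longrightarrow> vin n (f v))
     \<and> (\<forall>v w. vin n v \<longrightarrow> vin n w \<longrightarrow> f (v + w) = f v + f w)
     \<and> (\<forall>c v. vin n v \<longrightarrow> f (\<lambda>i. c * v i) = (\<lambda>i. c * f v i))"

definition vec :: "'a::zero vect \<Rightarrow> 'a ext" where
  "vec v = (\<lambda>(I, p). if \<not> p \<and> card I = 1 then v (Min I) else 0)"

definition vpart :: "'a ext \<Rightarrow> 'a vect" where
  "vpart x = (\<lambda>i. x ({i}, False))"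

definition gone :: "'a::{zero,one} ext" where
  "gone = (\<lambda>(I, p). if I = {} \<and> \<not> p then 1 else 0)"

definition smult :: "'a::times \<Rightarrow> 'a ext \<Rightarrow> 'a ext" where
  "smult c x = (\<lambda>K. c * x K)"

definition neg :: "'a ext \<Rightarrow> 'a ext" where
  "neg x = (\<lambda>(I, p). if 2 \<le> card I then x (I, \<not> p) else x (I, p))"

definition negp :: "bool \<Rightarrow> 'a ext \<Rightarrow> 'a ext" where
  "negp p x = (if p then neg x else x)"

text \<open>number of inversions of the concatenation of the increasing lists of I and J\<close>
definition ninv :: "nat set \<Rightarrow> nat set \<Rightarrow> nat" where
  "ninv I J = card {(i, j). i \<in> I \<and> j \<in> J \<and> j < i}"

text \<open>the wedge product, bilinear extension of
  b_I \<and> b_J = 0 if I, J meet, = b_(I\<union>J) or its negation according to the sign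
  of the sorting permutation\<close>
definition wedge :: "'a::comm_semiring_1 ext \<Rightarrow> 'a ext \<Rightarrow> 'a ext" where
  "wedge x y = (\<lambda>(K, r). \<Sum>I\<in>Pow K. \<Sum>p\<in>UNIV. \<Sum>q\<in>UNIV.
      if (p \<noteq> q) = (r \<noteq> odd (ninv I (K - I))) then x (I, p) * y (K - I, q) else 0)"

definition wedge_list :: "'a::comm_semiring_1 vect list \<Rightarrow> 'a ext" where
  "wedge_list us = foldr (\<lambda>u acc. wedge (vec u) acc) us gone"

definition basis_list :: "nat set \<Rightarrow> 'a::{zero,one} vect list" where
  "basis_list I = map bv (sorted_list_of_set I)"

text \<open>HS f k [u_1,...,u_r] = D_k (u_1 \<and> ... \<and> u_r)
   = sum over i_1+...+i_r = k of f^i_1 u_1 \<and> ... \<and> f^i_r u_r\<close>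
fun HS :: "('a::comm_semiring_1 vect \<Rightarrow> 'a vect) \<Rightarrow> nat \<Rightarrow> 'a vect list \<Rightarrow> 'a ext" where
  "HS f k [] = (if k = 0 then gone else 0)"
| "HS f k (u # us) = (\<Sum>i\<le>k. wedge (vec ((f ^^ i) u)) (HS f (k - i) us))"

definition Dk :: "nat \<Rightarrow> ('a::comm_semiring_1 vect \<Rightarrow> 'a vect) \<Rightarrow> nat \<Rightarrow> 'a ext \<Rightarrow> 'a ext" where
  "Dk n f k x = (\<Sum>K\<in>gkeys n. smult (x K) (negp (snd K) (HS f k (basis_list (fst K)))))"

definition Qbar :: "('a::comm_semiring_1 vect \<Rightarrow> 'a vect) \<Rightarrow> nat \<Rightarrow> 'a vect list \<Rightarrow> 'a ext" where
  "Qbar f j us = (neg ^^ j)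
     (\<Sum>S\<in>{S. S \<subseteq> {..<length us} \<and> card S = j}.
        wedge_list (map (\<lambda>k. if k \<in> S then f (us ! k) else us ! k) [0..<length us]))"

text \<open>Dbar_j, the A-linear extension on degrees \<ge> 2 (components of degree < 2 are dropped)\<close>
definition Dbar :: "nat \<Rightarrow> ('a::comm_semiring_1 vect \<Rightarrow> 'a vect) \<Rightarrow> nat \<Rightarrow> 'a ext \<Rightarrow> 'a ext" where
  "Dbar n f j x = (\<Sum>K\<in>{K \<in> gkeys n. 2 \<le> card (fst K)}.
      smult (x K) (negp (snd K) (Qbar f j (basis_list (fst K)))))"

text \<open>z^k-coefficient of  Dbar(z) (D(z) u \<and> v)\<close>
definition lhs_coeff :: "nat \<Rightarrow> ('a::comm_semiring_1 vect \<Rightarrow> 'a vect) \<Rightarrow> 'a ext \<Rightarrow> 'a ext \<Rightarrow> nat \<Rightarrow> 'a ext" where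
  "lhs_coeff n f u v k = (\<Sum>j\<le>k. Dbar n f j (wedge (Dk n f (k - j) u) v))"

text \<open>z^k-coefficient of  u \<and> Dbar(z) v : for the degree \<ge> 2 part of v this is
  u \<and> Dbar_k v, for the degree-1 part v_1 it is u \<and> v_1 + z (-)(u \<and> f(v_1))\<close>
definition rhs_coeff :: "nat \<Rightarrow> ('a::comm_semiring_1 vect \<Rightarrow> 'a vect) \<Rightarrow> 'a ext \<Rightarrow> 'a ext \<Rightarrow> nat \<Rightarrow> 'a ext" where
  "rhs_coeff n f u v k = wedge u (Dbar n f k v)
     + (if k = 0 then wedge u (vec (vpart v))
        else if k = 1 then neg (wedge u (vec (f (vpart v))))
        else 0)"

definition high :: "'a::zero ext \<Rightarrow> bool" where
  "high x \<longleftrightarrow> (\<forall>I p. card I < 2 \<longrightarrow> x (I, p) = 0)"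

definition qgens :: "nat \<Rightarrow> 'a::comm_semiring_1 ext set" where
  "qgens n = {x + neg x | x. gwf n x \<and> high x}
           \<union> {wedge (vec w) (vec w) | w. vin n w}"

inductive_set qideal :: "nat \<Rightarrow> 'a::comm_semiring_1 ext set" for n where
  qzero: "0 \<in> qideal n"
| qgen: "g \<in> qgens n \<Longrightarrow> gwf n a \<Longrightarrow> gwf n b \<Longrightarrow> wedge (wedge a g) b \<in> qideal n"
| qadd: "x \<in> qideal n \<Longrightarrow> y \<in> qideal n \<Longrightarrow> x + y \<in> qideal n"

definition succeq :: "nat \<Rightarrow> 'a::comm_semiring_1 ext \<Rightarrow> 'a ext \<Rightarrow> bool" where
  "succeq n x y \<longleftrightarrow> (\<exists>d\<in>qideal n. x = y + d)"

end

theory Submission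
  imports Defs "HOL-Library.Poly_Mapping" "HOL-Library.Multiset"
begin

text \<open>
  By bilinearity \<open>u\<close> and \<open>v\<close> may be taken to be basis elements. In the classical exterior algebra
  both sides agree: the quasi-inverse is multiplicative there, and
  \<open>\<Sum>\<^sub>i z\<^sup>i (f\<^sup>i u - z f\<^sup>i\<^sup>+\<^sup>1 u)\<close> telescopes to \<open>u\<close>. This only gives \<open>LHS + d = RHS + e\<close> with
  quasi-zeros \<open>d\<close> and \<open>e\<close>, and \<open>d\<close> cannot be cancelled over a general semiring. Therefore \<open>f\<close> is
  first replaced by a generic matrix over the polynomial semiring in its entries with natural
  coefficients. There every monomial of the right-hand side occurs at exactly one basis key,
  because the columns occurring in it say which factors \<open>f\<close> was applied to. So no monomial
  appears with both signs, the equality of differences forces \<open>LHS = RHS + quasi-zero\<close>,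
  and this specialises to every \<open>f\<close>.
\<close>

subsection \<open>Signed exterior calculus without cancellation\<close>

text \<open>Where addition is idempotent, as in the Boolean semiring, LHS + d = RHS + e says very
  little about LHS. The quasi-zeros \<open>d\<close> and \<open>e\<close> have two origins. A
  product with a repeated index is 0, while the subset sum attached to the list with that repetition
  is only invariant under change of sign; and telescoping leaves a remainder of the form
  \<open>C + flip C\<close>. Natural coefficients serve two purposes. They are cancellative with a
  truncated subtraction, so the required quasi-zero can be written down as LHS - RHS; and, unlike
  the integers, they map to every commutative semiring. The right-hand side can be followed monomial
  by monomial because the basis element \<open>u\<close> brings no variables into it. Each factor
  b_j of \<open>v\<close> contributes either b_j itself or the sum of all x_lj b_l. A variable x_lj
  in the monomial thus tells both that \<open>f\<close> was applied to b_j and that b_l was picked,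
  so the whole list of wedged basis vectors, hence its index set and its sign, can be read
  off.\<close>

text \<open>Unlike \<open>neg\<close>, the map \<open>flip\<close> exchanges the two signs in degrees 0 and 1 as well; it commutes
  with \<open>wedge\<close> in every degree, at the price of leaving the set of well-formed elements.\<close>

definition flip :: "'a ext \<Rightarrow> 'a ext" where
  "flip x = (\<lambda>(I, p). x (I, \<not> p))"

definition bkey :: "nat set \<Rightarrow> bool \<Rightarrow> 'a::{zero,one} ext" where
  "bkey I p = (\<lambda>K. if K = (I, p) then 1 else 0)"

lemma flip_apply [simp]: "flip x (I, p) = x (I, \<not> p)"
  by (simp add: flip_def)

lemma flip_flip [simp]: "flip (flip x) = x"
  by (auto simp: flip_def)

lemma flip_add: "flip (x + y) = flip x + flip y"
  by (auto simp: flip_def)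

lemma flip_zero [simp]: "flip 0 = 0"
  by (auto simp: flip_def)

lemma sum_ext_apply: "(\<Sum>i\<in>A. g i) K = (\<Sum>i\<in>A. g i K)" for g :: "'b \<Rightarrow> 'c \<Rightarrow> 'd::comm_monoid_add"
  by (induction A rule: infinite_finite_induct) auto

lemma flip_sum: "flip (\<Sum>i\<in>A. g i) = (\<Sum>i\<in>A. flip (g i))"
  by (auto simp: fun_eq_iff sum_ext_apply)

lemma smult_apply [simp]: "smult c x K = c * x K"
  by (simp add: smult_def)

lemma flip_smult: "flip (smult c x) = smult c (flip x)"
  by (auto simp: fun_eq_iff)

lemma smult_add: "smult c (x + y) = smult c x + smult c y" for c :: "'a::comm_semiring_1"
  by (auto simp: fun_eq_iff algebra_simps)

lemma smult_sum: "smult c (\<Sum>i\<in>A. g i) = (\<Sum>i\<in>A. smult c (g i))" for c :: "'a::comm_semiring_1"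
  by (auto simp: fun_eq_iff sum_ext_apply sum_distrib_left)

lemma smult_smult: "smult c (smult d x) = smult (c * d) x" for c :: "'a::comm_semiring_1"
  by (auto simp: fun_eq_iff algebra_simps)

lemma funpow_flip_add: "(flip ^^ j) (x + y) = (flip ^^ j) x + (flip ^^ j) y"
  by (induction j) (auto simp: flip_add)

lemma funpow_flip_zero [simp]: "(flip ^^ j) 0 = 0"
  by (induction j) auto

lemma funpow_flip_sum: "(flip ^^ j) (\<Sum>i\<in>A. g i) = (\<Sum>i\<in>A. (flip ^^ j) (g i))"
  by (induction j) (auto simp: flip_sum)

text \<open>For given \<open>I\<close>, \<open>p\<close> and \<open>r\<close> exactly one sign
  \<open>q\<close> passes the parity test, so the innermost sum collapses to one term.\<close>

lemma wedge_apply: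
  "wedge x y (K, r) = (\<Sum>I\<in>Pow K. \<Sum>p\<in>UNIV. x (I, p) * y (K - I, p \<noteq> (r \<noteq> odd (ninv I (K - I)))))"
  unfolding wedge_def by (auto simp: UNIV_bool intro!: sum.cong)

section \<open>Bilinearity, associativity and sign rules of the wedge product\<close>

lemma wedge_add_left: "wedge (x + x') y = wedge x y + wedge x' y"
  by (auto simp: fun_eq_iff wedge_apply algebra_simps sum.distrib)

lemma wedge_add_right: "wedge x (y + y') = wedge x y + wedge x y'"
  by (auto simp: fun_eq_iff wedge_apply algebra_simps sum.distrib)

lemma wedge_zero_left [simp]: "wedge 0 y = 0"
  by (auto simp: fun_eq_iff wedge_apply)

lemma wedge_zero_right [simp]: "wedge x 0 = 0"
  by (auto simp: fun_eq_iff wedge_apply)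

lemma wedge_smult_left: "wedge (smult c x) y = smult c (wedge x y)"
  by (auto simp: fun_eq_iff wedge_apply sum_distrib_left algebra_simps)

lemma wedge_smult_right: "wedge x (smult c y) = smult c (wedge x y)"
  by (auto simp: fun_eq_iff wedge_apply sum_distrib_left algebra_simps)

lemma wedge_sum_left: "wedge (\<Sum>i\<in>A. g i) y = (\<Sum>i\<in>A. wedge (g i) y)"
  by (induction A rule: infinite_finite_induct) (simp_all only: sum.infinite sum.empty sum.insert wedge_add_left wedge_zero_left not_False_eq_True)

lemma wedge_sum_right: "wedge x (\<Sum>i\<in>A. g i) = (\<Sum>i\<in>A. wedge x (g i))"
  by (induction A rule: infinite_finite_induct) (simp_all only: sum.infinite sum.empty sum.insert wedge_add_right wedge_zero_right not_False_eq_True)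

lemma wedge_flip_left: "wedge (flip x) y = flip (wedge x y)"
  by (auto simp: fun_eq_iff wedge_apply UNIV_bool add.commute intro!: sum.cong)

lemma wedge_flip_right: "wedge x (flip y) = flip (wedge x y)"
  by (auto simp: fun_eq_iff wedge_apply UNIV_bool add.commute intro!: sum.cong)

lemma wedge_funpow_flip_right: "wedge x ((flip ^^ j) y) = (flip ^^ j) (wedge x y)"
  by (induction j) (auto simp: wedge_flip_right)

text \<open>Together with \<open>ninv_Un_right\<close> this is the cocycle property of the sorting
  sign: both bracketings of three factors count the same inversions.\<close>

lemma ninv_Un_left:
  assumes "finite I" "finite J" "finite L" "I \<inter> J = {}"
  shows "ninv (I \<union> J) L = ninv I L + ninv J L"
proof -
  have "{(i, j). i \<in> I \<union> J \<and> j \<in> L \<and> j < i} = {(i, j). i \<in> I \<and> j \<in> L \<and> j < i} \<union> {(i, j). i \<in> J \<and> j \<in> L \<and> j < i}"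
    by auto
  moreover have "finite {(i, j). i \<in> I \<and> j \<in> L \<and> j < i}" "finite {(i, j). i \<in> J \<and> j \<in> L \<and> j < i}"
    using assms by (auto intro: finite_subset[of _ "I \<times> L"] finite_subset[of _ "J \<times> L"])
  ultimately show ?thesis
    using assms unfolding ninv_def by (simp add: card_Un_disjoint disjoint_iff)
qed

lemma ninv_Un_right:
  assumes "finite I" "finite J" "finite L" "J \<inter> L = {}"
  shows "ninv I (J \<union> L) = ninv I J + ninv I L"
proof -
  have "{(i, j). i \<in> I \<and> j \<in> J \<union> L \<and> j < i} = {(i, j). i \<in> I \<and> j \<in> J \<and> j < i} \<union> {(i, j). i \<in> I \<and> j \<in> L \<and> j < i}"
    by auto
  moreover have "finite {(i, j). i \<in> I \<and> j \<in> L \<and> j < i}" "finite {(i, j). i \<in> I \<and> j \<in> J \<and> j < i}"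
    using assms by (auto intro: finite_subset[of _ "I \<times> L"] finite_subset[of _ "I \<times> J"])
  ultimately show ?thesis
    using assms unfolding ninv_def by (simp add: card_Un_disjoint disjoint_iff)
qed

lemma ninv_empty [simp]: "ninv {} J = 0" "ninv I {} = 0"
  by (auto simp: ninv_def)

text \<open>Chains \<open>I \<subseteq> M \<subseteq> K\<close> correspond to disjoint pairs
  \<open>I\<close>, \<open>J\<close> through \<open>J = M - I\<close>.\<close>

lemma sum_Pow_Pow:
  assumes "finite K"
  shows "(\<Sum>M\<in>Pow K. \<Sum>I\<in>Pow M. g I M) = (\<Sum>I\<in>Pow K. \<Sum>J\<in>Pow (K - I). g I (I \<union> J))"
proof -
  have "(\<Sum>M\<in>Pow K. \<Sum>I\<in>Pow M. g I M) = (\<Sum>(M, I)\<in>(SIGMA M:Pow K. Pow M). g I M)"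
    using assms by (intro sum.Sigma) (auto intro: finite_subset)
  also have "\<dots> = (\<Sum>(I, J)\<in>(SIGMA I:Pow K. Pow (K - I)). g I (I \<union> J))"
    by (rule sum.reindex_bij_witness[of _ "\<lambda>(I, J). (I \<union> J, I)" "\<lambda>(M, I). (I, M - I)"])
       (auto simp: Un_absorb1)
  also have "\<dots> = (\<Sum>I\<in>Pow K. \<Sum>J\<in>Pow (K - I). g I (I \<union> J))"
    using assms by (intro sum.Sigma[symmetric]) (auto intro: finite_subset)
  finally show ?thesis .
qed

text \<open>For fixed \<open>s\<close> the substitution
  \<open>t = (s \<noteq> (p \<noteq> a))\<close> permutes the two signs: it replaces the sign of the
  intermediate product by that of the second factor. In associativity \<open>a\<close>,
  \<open>b\<close>, \<open>c\<close> are the inversion parities of the three pairs of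
  blocks.\<close>

lemma sum_bool_signs:
  fixes X Y Z :: "bool \<Rightarrow> 'a::comm_semiring_1"
  shows "(\<Sum>p\<in>UNIV. \<Sum>s\<in>UNIV. X s * Y (s \<noteq> (p \<noteq> a)) * Z (p \<noteq> (r \<noteq> (b \<noteq> c))))
    = (\<Sum>s\<in>UNIV. \<Sum>t\<in>UNIV. X s * (Y t * Z (t \<noteq> ((s \<noteq> (r \<noteq> (a \<noteq> b))) \<noteq> c))))"
  by (cases a; cases b; cases c; cases r; simp add: UNIV_bool ac_simps)

lemma wedge_assoc: "wedge (wedge x y) z = wedge x (wedge y z)"
proof (rule ext, clarify)
  fix K r
  show "wedge (wedge x y) z (K, r) = wedge x (wedge y z) (K, r)"
  proof (cases "finite K")
    case False
    \<comment> \<open>For infinite \<open>K\<close> both sides are sums over the infinite set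
      \<open>Pow K\<close>, hence 0 by convention.\<close>
    then show ?thesis by (simp add: wedge_apply[of _ _ K])
  next
    case fin: True
    define g where "g I M = (\<Sum>p\<in>UNIV. \<Sum>s\<in>UNIV. x (I, s) * y (M - I, s \<noteq> (p \<noteq> odd (ninv I (M - I)))) * z (K - M, p \<noteq> (r \<noteq> odd (ninv M (K - M)))))" for I M
    have "wedge (wedge x y) z (K, r) = (\<Sum>M\<in>Pow K. \<Sum>I\<in>Pow M. g I M)"
      unfolding wedge_apply g_def sum_distrib_right by (rule sum.cong[OF refl], rule sum.swap)
    also have "\<dots> = (\<Sum>I\<in>Pow K. \<Sum>J\<in>Pow (K - I). g I (I \<union> J))"
      using fin by (rule sum_Pow_Pow)
    also have "\<dots> = (\<Sum>I\<in>Pow K. \<Sum>J\<in>Pow (K - I). \<Sum>s\<in>UNIV. \<Sum>t\<in>UNIV. x (I, s) * (y (J, t) * z (K - I - J, t \<noteq> ((s \<noteq> (r \<noteq> odd (ninv I (K - I)))) \<noteq> odd (ninv J (K - I - J))))))"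
    proof (intro sum.cong refl)
      fix I J assume I: "I \<in> Pow K" and J: "J \<in> Pow (K - I)"
      define L where "L = K - I - J"
      have f: "finite I" "finite J" "finite L" using I J fin by (auto simp: L_def intro: finite_subset)
      have e: "(I \<union> J) - I = J" "K - (I \<union> J) = L" "K - I = J \<union> L" using I J by (auto simp: L_def)
      have n1: "ninv (I \<union> J) L = ninv I L + ninv J L" 
        using f I J by (intro ninv_Un_left) auto
      have n2: "ninv I (J \<union> L) = ninv I J + ninv I L" 
        using f I J by (intro ninv_Un_right) (auto simp: L_def)
      have e2: "K - I - J = L" by (simp add: L_def)
      show "g I (I \<union> J) = (\<Sum>s\<in>UNIV. \<Sum>t\<in>UNIV. x (I, s) * (y (J, t) * z (K - I - J, t \<noteq> ((s \<noteq> (r \<noteq> odd (ninv I (K - I)))) \<noteq> odd (ninv J (K - I - J))))))"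
        unfolding g_def e2 unfolding e n1 n2 odd_add by (rule sum_bool_signs)
    qed
    also have "\<dots> = wedge x (wedge y z) (K, r)"
      unfolding wedge_apply sum_distrib_left by (rule sum.cong[OF refl], rule sum.swap)
    finally show ?thesis .
  qed
qed

text \<open>Laplace expansion along the first factor: \<open>vec w\<close> lives on unprimed
  singletons, so only \<open>I = {i}\<close> contributes.\<close>

lemma vec_wedge_apply:
  "wedge (vec w) x (K, r) = (\<Sum>i\<in>K. w i * x (K - {i}, r \<noteq> odd (ninv {i} (K - {i}))))"
proof (cases "finite K")
  case False
  then show ?thesis by (simp add: wedge_apply)
next
  case True
  have "wedge (vec w) x (K, r) = (\<Sum>I\<in>(\<lambda>i. {i}) ` K. \<Sum>p\<in>UNIV. vec w (I, p) * x (K - I, p \<noteq> (r \<noteq> odd (ninv I (K - I)))))"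
    unfolding wedge_apply using True
    by (intro sum.mono_neutral_right) (auto simp: vec_def card_1_singleton_iff UNIV_bool)
  also have "\<dots> = (\<Sum>i\<in>K. w i * x (K - {i}, r \<noteq> odd (ninv {i} (K - {i}))))"
    by (subst sum.reindex) (auto simp: UNIV_bool vec_def)
  finally show ?thesis .
qed

lemma bkey_wedge_apply:
  "wedge (bkey I p) x (K, r) = (if finite K \<and> I \<subseteq> K then x (K - I, p \<noteq> (r \<noteq> odd (ninv I (K - I)))) else 0)"
proof (cases "finite K")
  case False
  then show ?thesis by (simp add: wedge_apply)
next
  case True
  have "wedge (bkey I p) x (K, r) = (\<Sum>J\<in>Pow K. if J = I then x (K - J, p \<noteq> (r \<noteq> odd (ninv J (K - J)))) else 0)"
    unfolding wedge_apply by (intro sum.cong) (auto simp: UNIV_bool bkey_def)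
  then show ?thesis using True by (simp add: sum.delta)
qed

lemma gone_eq_bkey: "gone = bkey {} False"
  by (auto simp: gone_def bkey_def fun_eq_iff)

text \<open>The hypothesis reflects that every value of \<open>wedge\<close> at an infinite index
  set is 0.\<close>

lemma wedge_gone_left:
  assumes "\<And>K p. infinite K \<Longrightarrow> x (K, p) = 0"
  shows "wedge gone x = x"
  using assms by (auto simp: gone_eq_bkey bkey_wedge_apply fun_eq_iff)

lemma wedge_gone_right:
  assumes "\<And>K p. infinite K \<Longrightarrow> x (K, p) = 0"
  shows "wedge x gone = x"
proof (rule ext, clarify)
  fix K r
  show "wedge x gone (K, r) = x (K, r)"
  proof (cases "finite K")
    case True
    have "wedge x gone (K, r) = (\<Sum>I\<in>Pow K. if I = K then x (I, r) else 0)"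
      unfolding wedge_apply by (intro sum.cong) (auto simp: gone_def UNIV_bool)
    then show ?thesis using True by (simp add: sum.delta)
  qed (simp add: assms wedge_apply)
qed

lemma ninv_singleton: "ninv {i} J = card {j \<in> J. j < i}"
proof -
  have "{(a, j). a \<in> {i} \<and> j \<in> J \<and> j < a} = Pair i ` {j \<in> J. j < i}" by auto
  then show ?thesis unfolding ninv_def by (simp add: card_image inj_on_def)
qed

lemma ninv_swap_pair:
  assumes "i \<noteq> j" shows "odd (ninv {i} {j}) \<longleftrightarrow> even (ninv {j} {i})"
proof -
  have "{a \<in> {j}. a < i} = (if j < i then {j} else {})" for i j :: nat by auto
  then show ?thesis using assms by (simp add: ninv_singleton)
qed

text \<open>At a two-element key the two signs carry the two cross products of coordinates, and
  exchanging the vectors exchanges them; at other keys both sides vanish. For \<open>u = w\<close>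
  this gives invariance under \<open>flip\<close>, not 0.\<close>

lemma vec_wedge_swap: "wedge (vec u) (vec w) = flip (wedge (vec w) (vec u))"
proof (rule ext, clarify)
  fix K r
  show "wedge (vec u) (vec w) (K, r) = flip (wedge (vec w) (vec u)) (K, r)"
  proof (cases "card K = 2")
    case True
    then obtain i j where K: "K = {i, j}" "i \<noteq> j" by (meson card_2_iff)
    have d: "{i, j} - {i} = {j}" "{i, j} - {j} = {i}" using K by auto
    have s: "even (ninv {j} {i}) = odd (ninv {i} {j})" using ninv_swap_pair[OF K(2)] by blast
    show ?thesis
      unfolding K(1) flip_apply vec_wedge_apply using K(2)
      by (simp add: d s vec_def mult.commute add.commute)
  next
    case False
    have "vec w (K - {i}, q) = 0" if "i \<in> K" for w :: "'a vect" and i q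
    proof -
      have "card (K - {i}) \<noteq> 1"
      proof (cases "finite K")
        case True
        have "card K \<noteq> 0" using that True by auto
        then show ?thesis using that \<open>card K \<noteq> 2\<close> by (simp add: card_Diff_singleton)
      qed simp
      then show ?thesis by (simp add: vec_def)
    qed
    then show ?thesis by (simp add: vec_wedge_apply)
  qed
qed

subsection \<open>Elementary sums over subsets\<close>

text \<open>In contrast to \<open>gwf\<close>, both signs are allowed in every degree, which makes
  the notion stable under \<open>flip\<close>. The element 0 is homogeneous of every degree.\<close>

definition homog :: "nat \<Rightarrow> nat \<Rightarrow> 'a::zero ext \<Rightarrow> bool" where
  "homog n d x \<longleftrightarrow> (\<forall>I p. x (I, p) \<noteq> 0 \<longrightarrow> I \<subseteq> {..<n} \<and> card I = d)"

lemma homogD: "homog n d x \<Longrightarrow> x (I, p) \<noteq> 0 \<Longrightarrow> I \<subseteq> {..<n} \<and> card I = d"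
  unfolding homog_def by blast

lemma homog_zero [simp]: "homog n d 0"
  by (simp add: homog_def)

lemma homog_add: "homog n d x \<Longrightarrow> homog n d y \<Longrightarrow> homog n d (x + y)" for x :: "'a::comm_monoid_add ext"
  unfolding homog_def by (metis add.right_neutral add.left_neutral plus_fun_apply)

lemma homog_sum: "(\<And>i. i \<in> A \<Longrightarrow> homog n d (g i)) \<Longrightarrow> homog n d (\<Sum>i\<in>A. g i)"
  for g :: "'b \<Rightarrow> 'a::comm_monoid_add ext"
  unfolding homog_def sum_ext_apply by (metis (no_types, lifting) sum.neutral)

lemma homog_flip [simp]: "homog n d (flip x) \<longleftrightarrow> homog n d x"
  unfolding homog_def flip_apply ex_bool_eq all_bool_eq by auto

lemma homog_funpow_flip [simp]: "homog n d ((flip ^^ j) x) \<longleftrightarrow> homog n d x"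
  by (induction j) auto

lemma homog_smult: "homog n d x \<Longrightarrow> homog n d (smult c x)" for c :: "'a::comm_semiring_1"
  unfolding homog_def by (metis mult_zero_right smult_apply)

lemma homog_bkey: "I \<subseteq> {..<n} \<Longrightarrow> card I = d \<Longrightarrow> homog n d (bkey I p)"
  unfolding homog_def bkey_def by auto

lemma homog_gone: "homog n 0 gone"
  unfolding homog_def gone_def by auto

lemma homog_vec: "vin n w \<Longrightarrow> homog n 1 (vec w)"
  unfolding homog_def vec_def vin_def by (auto simp: card_1_singleton_iff split: if_splits) (meson not_le)

lemma homog_wedge:
  assumes "homog n d x" "homog n e y"
  shows "homog n (d + e) (wedge x y)"
  unfolding homog_def
proof (intro allI impI)
  fix K r assume "wedge x y (K, r) \<noteq> 0"
  then obtain I where "I \<in> Pow K" "(\<Sum>p\<in>UNIV. x (I, p) * y (K - I, p \<noteq> (r \<noteq> odd (ninv I (K - I))))) \<noteq> 0"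
    unfolding wedge_apply by (meson sum.neutral)
  then obtain p q where I: "I \<subseteq> K" and "x (I, p) * y (K - I, q) \<noteq> 0"
    by (metis (no_types, lifting) PowD sum.neutral)
  then have "x (I, p) \<noteq> 0" "y (K - I, q) \<noteq> 0" by auto
  then have a: "I \<subseteq> {..<n}" "card I = d" "K - I \<subseteq> {..<n}" "card (K - I) = e"
    using homogD[OF assms(1)] homogD[OF assms(2)] by auto
  then have "finite K" using I by (metis finite_Diff2 finite_lessThan finite_subset)
  then have "card K = card I + card (K - I)"
    using I by (metis add_diff_inverse_nat card_Diff_subset card_mono finite_subset not_less)
  then show "K \<subseteq> {..<n} \<and> card K = d + e" using a I by auto
qed

lemma homog_finite: "homog n d x \<Longrightarrow> infinite K \<Longrightarrow> x (K, p) = 0"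
  by (metis homogD finite_lessThan finite_subset)

text \<open>The two maps differ only in degrees 0 and 1. A product of two elements of positive
  degree has degree at least 2, so the given negation can be traded for one that commutes with
  \<open>wedge\<close> throughout.\<close>

lemma neg_homog: "homog n d x \<Longrightarrow> 2 \<le> d \<Longrightarrow> neg x = flip x"
  unfolding neg_def flip_def by (auto simp: fun_eq_iff) (metis homogD)

lemma funpow_neg_homog: "homog n d x \<Longrightarrow> 2 \<le> d \<Longrightarrow> (neg ^^ j) x = (flip ^^ j) x"
proof (induction j)
  case (Suc j)
  then have "(neg ^^ Suc j) x = neg ((flip ^^ j) x)" by simp
  also have "\<dots> = flip ((flip ^^ j) x)" using Suc by (intro neg_homog[of n d]) auto
  finally show ?case by simp
qed simp

lemma vin_endo: "endo n f \<Longrightarrow> vin n w \<Longrightarrow> vin n (f w)"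
  by (simp add: endo_def)

lemma vin_funpow: "endo n f \<Longrightarrow> vin n w \<Longrightarrow> vin n ((f ^^ i) w)"
  by (induction i) (auto simp: vin_endo)

lemma vin_bv: "i < n \<Longrightarrow> vin n (bv i)"
  by (auto simp: vin_def bv_def)

text \<open>The signs are left out because \<open>neg\<close> is trivial in degree 1, so that \<open>Qbar\<close> itself satisfies
  no such recursion on lists.\<close>

fun esum :: "('a::comm_semiring_1 vect \<Rightarrow> 'a vect) \<Rightarrow> nat \<Rightarrow> 'a vect list \<Rightarrow> 'a ext" where
  "esum f j [] = (if j = 0 then gone else 0)"
| "esum f j (u # us) = wedge (vec u) (esum f j us)
     + (case j of 0 \<Rightarrow> 0 | Suc i \<Rightarrow> wedge (vec (f u)) (esum f i us))"

lemma homog_esum: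
  assumes "endo n f"
  shows "(\<And>u. u \<in> set us \<Longrightarrow> vin n u) \<Longrightarrow> homog n (length us) (esum f j us)"
proof (induction us arbitrary: j)
  case (Cons u us)
  have "homog n (1 + length us) (wedge (vec w) (esum f i us))" if "vin n w" for w i
    using that Cons by (intro homog_wedge homog_vec) auto
  then show ?case
    using Cons.prems vin_endo[OF assms] by (cases j) (simp_all add: homog_add del: plus_fun_apply)
qed (auto simp: homog_gone)

lemma homog_HS:
  assumes "endo n f"
  shows "(\<And>u. u \<in> set us \<Longrightarrow> vin n u) \<Longrightarrow> homog n (length us) (HS f k us)"
proof (induction us arbitrary: k)
  case (Cons u us)
  have "homog n (1 + length us) (wedge (vec w) (HS f i us))" if "vin n w" for w i
    using that Cons by (intro homog_wedge homog_vec) auto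
  then show ?case
    using Cons.prems assms by (simp add: homog_sum vin_funpow)
qed (auto simp: homog_gone)

lemma wedge_list_Nil [simp]: "wedge_list [] = gone"
  and wedge_list_Cons [simp]: "wedge_list (u # us) = wedge (vec u) (wedge_list us)"
  by (simp_all add: wedge_list_def)

section \<open>Subset sums as a recursion over the list of factors\<close>

definition ksubsets :: "nat \<Rightarrow> nat \<Rightarrow> nat set set" where
  "ksubsets m j = {S. S \<subseteq> {..<m} \<and> card S = j}"

lemma finite_ksubsets [simp]: "finite (ksubsets m j)"
  unfolding ksubsets_def by (rule finite_subset[of _ "Pow {..<m}"]) auto

lemma subset_lessThan_Suc_cases:
  assumes "S \<subseteq> {..<Suc m}"
  obtains T where "T \<subseteq> {..<m}" "S = Suc ` T" | T where "T \<subseteq> {..<m}" "S = insert 0 (Suc ` T)"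
proof -
  define T where "T = {k. Suc k \<in> S}"
  have T: "T \<subseteq> {..<m}" using assms by (auto simp: T_def)
  have "S = Suc ` T \<or> S = insert 0 (Suc ` T)"
  proof (cases "0 \<in> S")
    case True
    have "S = insert 0 (Suc ` T)"
      unfolding T_def using True by (auto simp: image_iff) (metis not0_implies_Suc)
    then show ?thesis ..
  next
    case False
    have "S = Suc ` T"
      unfolding T_def using False by (auto simp: image_iff) (metis not0_implies_Suc)
    then show ?thesis ..
  qed
  then show thesis using that T by blast
qed

lemma ksubsets_Suc:
  "ksubsets (Suc m) j = (\<lambda>T. Suc ` T) ` ksubsets m j
     \<union> (case j of 0 \<Rightarrow> {} | Suc i \<Rightarrow> (\<lambda>T. insert 0 (Suc ` T)) ` ksubsets m i)" (is "?L = ?R")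
proof
  have c: "card (Suc ` T) = card T" for T by (simp add: card_image)
  have c0: "card (insert 0 (Suc ` T)) = Suc (card T)" if "T \<subseteq> {..<m}" for T
    using that finite_subset[OF that] by (subst card_insert_disjoint) (auto simp: c)
  show "?L \<subseteq> ?R"
  proof
    fix S assume "S \<in> ?L"
    then have S: "S \<subseteq> {..<Suc m}" "card S = j" by (auto simp: ksubsets_def)
    from S(1) show "S \<in> ?R"
    proof (cases rule: subset_lessThan_Suc_cases)
      case (1 T)
      then show ?thesis using S c by (auto simp: ksubsets_def)
    next
      case (2 T)
      then have "j = Suc (card T)" using S c0 by auto
      then show ?thesis using 2 by (auto simp: ksubsets_def)
    qed
  qed
  show "?R \<subseteq> ?L"
    using c c0 by (auto simp: ksubsets_def split: nat.splits)
qed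

text \<open>Membership of position 0 in \<open>S\<close> decides whether the head enters as
  \<open>u\<close> or as \<open>f u\<close>; these are the two summands in the recursion of
  \<open>esum\<close>.\<close>

lemma sum_ksubsets_wedge_list:
  "(\<Sum>S\<in>ksubsets (length us) j. wedge_list (map (\<lambda>k. if k \<in> S then f (us ! k) else us ! k) [0..<length us]))
    = esum f j us"
proof (induction us arbitrary: j)
  case Nil
  have "ksubsets 0 j = (if j = 0 then {{}} else {})" by (auto simp: ksubsets_def)
  then show ?case by auto
next
  case (Cons u us)
  define g where "g S = wedge_list (map (\<lambda>k. if k \<in> S then f ((u # us) ! k) else (u # us) ! k) [0..<length (u # us)])" for S
  define h where "h S = wedge_list (map (\<lambda>k. if k \<in> S then f (us ! k) else us ! k) [0..<length us])" for S
  have up: "[0..<length (u # us)] = 0 # map Suc [0..<length us]"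
    by (simp add: upt_conv_Cons map_Suc_upt del: upt_Suc)
  have g1: "g (Suc ` T) = wedge (vec u) (h T)" for T
    unfolding g_def h_def up by (simp add: comp_def inj_image_mem_iff cong: if_cong)
  have g2: "g (insert 0 (Suc ` T)) = wedge (vec (f u)) (h T)" for T
    unfolding g_def h_def up by (simp add: comp_def inj_image_mem_iff cong: if_cong)
  have i1: "inj_on (\<lambda>T. Suc ` T) A" for A by (auto simp: inj_on_def inj_image_eq_iff)
  have i2: "inj_on (\<lambda>T. insert 0 (Suc ` T)) A" for A
  proof (rule inj_onI)
    fix S T assume "insert 0 (Suc ` S) = insert 0 (Suc ` T)"
    then have "Suc ` S = Suc ` T" by (auto simp: set_eq_iff)
    then show "S = T" by (simp add: inj_image_eq_iff)
  qed
  have IH: "(\<Sum>S\<in>ksubsets (length us) i. h S) = esum f i us" for i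
    using Cons.IH unfolding h_def .
  have "(\<Sum>S\<in>ksubsets (length (u # us)) j. g S)
    = (\<Sum>S\<in>(\<lambda>T. Suc ` T) ` ksubsets (length us) j. g S)
      + (\<Sum>S\<in>(case j of 0 \<Rightarrow> {} | Suc i \<Rightarrow> (\<lambda>T. insert 0 (Suc ` T)) ` ksubsets (length us) i). g S)"
    unfolding list.size add_Suc_right add_0_right ksubsets_Suc
    by (rule sum.union_disjoint) (auto split: nat.splits)
  also have "\<dots> = wedge (vec u) (esum f j us) + (case j of 0 \<Rightarrow> 0 | Suc i \<Rightarrow> wedge (vec (f u)) (esum f i us))"
    unfolding IH[symmetric] wedge_sum_right
    by (cases j) (simp_all only: sum.reindex[OF i1] sum.reindex[OF i2] comp_def g1 g2 nat.case sum.empty)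
  finally show ?case unfolding g_def esum.simps .
qed

lemma Qbar_eq: "Qbar f j us = (neg ^^ j) (esum f j us)"
  unfolding Qbar_def sum_ksubsets_wedge_list[unfolded ksubsets_def] ..

section \<open>Reordering the factors of a subset sum\<close>

definition flip_if :: "bool \<Rightarrow> 'a ext \<Rightarrow> 'a ext" where
  "flip_if p x = (if p then flip x else x)"

lemma funpow_flip_eq_flip_if: "(flip ^^ k) x = flip_if (odd k) x"
  by (induction k) (auto simp: flip_if_def)

lemma flip_if_flip_if: "flip_if p (flip_if q x) = flip_if (p \<noteq> q) x"
  by (auto simp: flip_if_def)

lemma flip_if_add: "flip_if p (x + y) = flip_if p x + flip_if p y"
  by (auto simp: flip_if_def flip_add)

lemma wedge_flip_if_right: "wedge x (flip_if p y) = flip_if p (wedge x y)"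
  by (auto simp: flip_if_def wedge_flip_right)

lemma wedge_flip_if_left: "wedge (flip_if p x) y = flip_if p (wedge x y)"
  by (auto simp: flip_if_def wedge_flip_left)

lemma vec_wedge_swap_assoc:
  "wedge (vec a) (wedge (vec b) x) = flip (wedge (vec b) (wedge (vec a) x))"
  by (metis vec_wedge_swap wedge_assoc wedge_flip_left)

text \<open>Each of the four choices of applying \<open>f\<close> to the first two factors turns
  into a choice for the exchanged list with the same number of applications, at the cost of one
  sign. Two recursion steps are unfolded, hence the split into \<open>j = 0\<close>,
  \<open>j = 1\<close> and larger \<open>j\<close>.\<close>

lemma esum_swap: "esum f j (u # w # us) = flip (esum f j (w # u # us))"
proof -
  note sw = vec_wedge_swap_assoc
  consider "j = 0" | "j = 1" | i where "j = Suc (Suc i)"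
    by (metis One_nat_def not0_implies_Suc)
  then show ?thesis
    by cases
      (simp_all only: esum.simps nat.case One_nat_def wedge_add_right flip_add wedge_zero_right flip_zero
        add_0_right sw[of w u] sw[of w "f u"] sw[of "f w" u] sw[of "f w" "f u"] flip_flip ac_simps)
qed

lemma esum_Cons_funpow_flip:
  assumes "\<And>i. esum f i us = (flip ^^ m) (esum f i ws)"
  shows "esum f j (u # us) = (flip ^^ m) (esum f j (u # ws))"
  by (cases j) (simp_all only: esum.simps nat.case assms wedge_funpow_flip_right funpow_flip_add funpow_flip_zero)

lemma esum_move: "esum f j (as @ u # bs) = (flip ^^ length as) (esum f j (u # as @ bs))"
proof (induction as arbitrary: j)
  case (Cons a as)
  have "esum f j ((a # as) @ u # bs) = (flip ^^ length as) (esum f j (a # u # as @ bs))"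
    unfolding append_Cons by (rule esum_Cons_funpow_flip) (rule Cons.IH)
  also have "\<dots> = (flip ^^ length as) (flip (esum f j (u # a # as @ bs)))"
    by (subst esum_swap) (rule refl)
  finally show ?case
    by (simp only: funpow_swap1 funpow.simps comp_apply list.size add_Suc_right add_0_right append_Cons)
qed simp

lemma sorted_list_of_set_split:
  fixes J :: "nat set" and i :: nat
  assumes "finite J"
  defines "as \<equiv> sorted_list_of_set {j \<in> J. j < i}" and "bs \<equiv> sorted_list_of_set {j \<in> J. i < j}"
  shows "i \<notin> J \<Longrightarrow> sorted_list_of_set J = as @ bs"
    and "sorted_list_of_set (insert i J) = as @ i # bs"
    and "length as = card {j \<in> J. j < i}"
proof -
  have s: "sorted as" "distinct as" "sorted bs" "distinct bs"
    "set as = {j \<in> J. j < i}" "set bs = {j \<in> J. i < j}"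
    using assms(1) by (auto simp: as_def bs_def)
  show "sorted_list_of_set J = as @ bs" if "i \<notin> J"
  proof -
    have "j < i \<or> i < j" if "j \<in> J" for j using that \<open>i \<notin> J\<close> by (metis linorder_neqE_nat)
    then have "set (as @ bs) = J" using s(5,6) by auto
    moreover have "sorted (as @ bs)" "distinct (as @ bs)"
      unfolding sorted_append distinct_append s(5,6) using s(1-4) by fastforce+
    ultimately show ?thesis by (metis sorted_list_of_set.idem_if_sorted_distinct)
  qed
  have "set (as @ i # bs) = insert i J"
    unfolding set_append list.set s(5,6) using linorder_neqE_nat by blast
  moreover have "sorted (as @ i # bs)" "distinct (as @ i # bs)"
    unfolding sorted_append distinct_append sorted_simps distinct.simps list.set s(5,6)
    using s(1-4) by fastforce+
  ultimately show "sorted_list_of_set (insert i J) = as @ i # bs"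
    by (metis sorted_list_of_set.idem_if_sorted_distinct)
  show "length as = card {j \<in> J. j < i}" by (simp add: as_def)
qed

text \<open>In the sorted list \<open>i\<close> is preceded by the elements of \<open>J\<close>
  below \<open>i\<close>; their number is \<open>ninv {i} J\<close>, and moving \<open>bv i\<close>
  to the front costs one sign for each.\<close>

lemma esum_basis_list_insert:
  assumes "finite J" "i \<notin> J"
  shows "esum f j (basis_list (insert i J)) = flip_if (odd (ninv {i} J)) (esum f j (bv i # basis_list J))"
  using esum_move[of f j "map bv (sorted_list_of_set {j \<in> J. j < i})" "bv i"]
    sorted_list_of_set_split[OF assms(1), of i] assms(2)
  by (simp add: basis_list_def ninv_singleton funpow_flip_eq_flip_if del: esum.simps)

text \<open>Once the second copy of \<open>bv i\<close> has been moved next to the first, exchanging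
  the two equal vectors changes the sign and leaves the list as it is. Classically the value would
  be 0; here only invariance under \<open>flip\<close> survives.\<close>

lemma flip_esum_repeat:
  assumes "finite J" "i \<in> J"
  shows "flip (esum (f :: 'a::comm_semiring_1 vect \<Rightarrow> 'a vect) j (bv i # basis_list J)) = esum f j (bv i # basis_list J)"
proof -
  define as bs :: "'a vect list" where "as = map bv (sorted_list_of_set {j \<in> J. j < i})"
    and "bs = map bv (sorted_list_of_set {j \<in> J. i < j})"
  have "basis_list J = as @ bv i # bs"
    using sorted_list_of_set_split(2)[OF assms(1), of i] assms(2)
    by (simp add: basis_list_def as_def bs_def insert_absorb)
  moreover have "esum f j (bv i # as @ bv i # bs) = (flip ^^ length as) (esum f j (bv i # bv i # as @ bs))"
    by (rule esum_Cons_funpow_flip) (rule esum_move)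
  ultimately show ?thesis
    using esum_swap[of f j "bv i" "bv i" "as @ bs"]
    by (metis funpow_swap1)
qed

subsection \<open>The classical identity\<close>

text \<open>Closed under exchange of the two signs, which \<open>gkeys\<close> is not; this is what
  lets \<open>esum_lin\<close> commute with \<open>flip\<close>.\<close>

definition fkeys :: "nat \<Rightarrow> (nat set \<times> bool) set" where
  "fkeys n = Pow {..<n} \<times> UNIV"

lemma finite_fkeys [simp]: "finite (fkeys n)"
  by (simp add: fkeys_def)

text \<open>Degrees 0 and 1, which \<open>Dbar\<close> discards, are kept, and the sign belonging to
  \<open>z^j\<close> is left out. The telescoping induction starts from \<open>v\<close>, whose
  degree may be 1.\<close>

definition esum_lin :: "nat \<Rightarrow> ('a::comm_semiring_1 vect \<Rightarrow> 'a vect) \<Rightarrow> nat \<Rightarrow> 'a ext \<Rightarrow> 'a ext" where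
  "esum_lin n f j x = (\<Sum>K\<in>fkeys n. smult (x K) (flip_if (snd K) (esum f j (basis_list (fst K)))))"

lemma smult_add_left: "smult (c + d) x = smult c x + smult d x" for c :: "'a::comm_semiring_1"
  by (auto simp: fun_eq_iff algebra_simps)

lemma smult_zero_left [simp]: "smult 0 x = 0" for x :: "'a::comm_semiring_1 ext"
  by (auto simp: fun_eq_iff)

lemma smult_zero_right [simp]: "smult c 0 = 0" for c :: "'a::comm_semiring_1"
  by (auto simp: fun_eq_iff)

lemma smult_one [simp]: "smult 1 x = x" for x :: "'a::comm_semiring_1 ext"
  by (auto simp: fun_eq_iff)

lemma esum_lin_zero [simp]: "esum_lin n f j 0 = 0"
  by (auto simp: esum_lin_def fun_eq_iff sum_ext_apply)

lemma esum_lin_add: "esum_lin n f j (x + y) = esum_lin n f j x + esum_lin n f j y"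
  unfolding esum_lin_def plus_fun_apply smult_add_left sum.distrib ..

lemma esum_lin_smult: "esum_lin n f j (smult c x) = smult c (esum_lin n f j x)"
  unfolding esum_lin_def smult_sum smult_smult smult_apply ..

lemma esum_lin_sum: "esum_lin n f j (\<Sum>i\<in>A. g i) = (\<Sum>i\<in>A. esum_lin n f j (g i))"
  by (induction A rule: infinite_finite_induct)
    (simp_all only: sum.infinite sum.empty sum.insert esum_lin_add esum_lin_zero not_False_eq_True)

lemma esum_lin_bkey:
  assumes "I \<subseteq> {..<n}"
  shows "esum_lin n f j (bkey I p) = flip_if p (esum f j (basis_list I))"
proof -
  have "esum_lin n f j (bkey I p) = (\<Sum>K\<in>fkeys n. if K = (I, p) then flip_if (snd K) (esum f j (basis_list (fst K))) else 0)"
    unfolding esum_lin_def by (intro sum.cong refl) (auto simp: bkey_def)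
  then show ?thesis using assms by (simp add: sum.delta fkeys_def)
qed

lemma homog_flip_if [simp]: "homog n d (flip_if p x) \<longleftrightarrow> homog n d x"
  by (simp add: flip_if_def)

lemma vin_basis_list: "I \<subseteq> {..<n} \<Longrightarrow> u \<in> set (basis_list I) \<Longrightarrow> vin n u"
  using finite_subset[of I "{..<n}"] by (auto simp: basis_list_def intro!: vin_bv)

lemma homog_esum_basis_list:
  fixes f :: "'a::comm_semiring_1 vect \<Rightarrow> 'a vect"
  assumes "endo n f" "I \<subseteq> {..<n}"
  shows "homog n (card I) (esum f j (basis_list I))"
proof -
  have "homog n (length (map (bv :: nat \<Rightarrow> 'a vect) (sorted_list_of_set I))) (esum f j (basis_list I))"
    unfolding basis_list_def[symmetric]
    using homog_esum[OF assms(1), of "basis_list I" j] vin_basis_list[OF assms(2)] by blast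
  then show ?thesis by simp
qed

lemma homog_HS_basis_list:
  fixes f :: "'a::comm_semiring_1 vect \<Rightarrow> 'a vect"
  assumes "endo n f" "I \<subseteq> {..<n}"
  shows "homog n (card I) (HS f k (basis_list I))"
proof -
  have "homog n (length (map (bv :: nat \<Rightarrow> 'a vect) (sorted_list_of_set I))) (HS f k (basis_list I))"
    unfolding basis_list_def[symmetric]
    using homog_HS[OF assms(1), of "basis_list I" k] vin_basis_list[OF assms(2)] by blast
  then show ?thesis by simp
qed

lemma negp_Qbar_basis_list:
  assumes "endo n f" "I \<subseteq> {..<n}" "2 \<le> card I"
  shows "negp p (Qbar f j (basis_list I)) = flip_if p ((flip ^^ j) (esum f j (basis_list I)))"
proof -
  note h = homog_esum_basis_list[OF assms(1,2), of j]
  have "Qbar f j (basis_list I) = (flip ^^ j) (esum f j (basis_list I))"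
    unfolding Qbar_eq using h assms(3) by (rule funpow_neg_homog)
  moreover have "neg ((flip ^^ j) (esum f j (basis_list I))) = flip ((flip ^^ j) (esum f j (basis_list I)))"
    using h assms(3) by (intro neg_homog[of n "card I"]) auto
  ultimately show ?thesis by (simp add: negp_def flip_if_def)
qed

lemma homog_esum_lin:
  assumes "endo n f" "homog n d x"
  shows "homog n d (esum_lin n f j x)"
  unfolding esum_lin_def
proof (rule homog_sum)
  fix K assume "K \<in> fkeys n"
  then obtain I p where K: "K = (I, p)" "I \<subseteq> {..<n}" by (auto simp: fkeys_def)
  show "homog n d (smult (x K) (flip_if (snd K) (esum f j (basis_list (fst K)))))"
  proof (cases "x K = 0")
    case False
    then have "card I = d" using homogD[OF assms(2)] K by blast
    then show ?thesis using homog_esum_basis_list[OF assms(1) K(2)] K by (auto intro!: homog_smult)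
  qed simp
qed

lemma Dbar_eq_esum_lin:
  assumes "endo n f" "homog n d x" "2 \<le> d"
  shows "Dbar n f j x = (flip ^^ j) (esum_lin n f j x)"
proof -
  have "Dbar n f j x = (\<Sum>K\<in>{K \<in> gkeys n. 2 \<le> card (fst K)}. (flip ^^ j) (smult (x K) (flip_if (snd K) (esum f j (basis_list (fst K))))))"
    unfolding Dbar_def
  proof (intro sum.cong refl)
    fix K assume "K \<in> {K \<in> gkeys n. 2 \<le> card (fst K)}"
    then have K: "fst K \<subseteq> {..<n}" "2 \<le> card (fst K)" by (auto simp: gkeys_def)
    show "smult (x K) (negp (snd K) (Qbar f j (basis_list (fst K))))
      = (flip ^^ j) (smult (x K) (flip_if (snd K) (esum f j (basis_list (fst K)))))"
      unfolding negp_Qbar_basis_list[OF assms(1) K]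
      by (auto simp: funpow_flip_eq_flip_if flip_if_def flip_smult)
  qed
  also have "\<dots> = (\<Sum>K\<in>fkeys n. (flip ^^ j) (smult (x K) (flip_if (snd K) (esum f j (basis_list (fst K))))))"
  proof (rule sum.mono_neutral_left)
    show "\<forall>K\<in>fkeys n - {K \<in> gkeys n. 2 \<le> card (fst K)}. (flip ^^ j) (smult (x K) (flip_if (snd K) (esum f j (basis_list (fst K))))) = 0"
    proof
      fix K assume K: "K \<in> fkeys n - {K \<in> gkeys n. 2 \<le> card (fst K)}"
      then have "\<not> 2 \<le> card (fst K)" by (auto simp: fkeys_def gkeys_def)
      then have "x K = 0" using homogD[OF assms(2), of "fst K" "snd K"] assms(3) by auto
      then show "(flip ^^ j) (smult (x K) (flip_if (snd K) (esum f j (basis_list (fst K))))) = 0" by simp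
    qed
  qed (auto simp: fkeys_def gkeys_def)
  finally show ?thesis unfolding esum_lin_def funpow_flip_sum .
qed

section \<open>Expansion of elements and endomorphisms in bases\<close>

lemma ext_expand:
  fixes x :: "'a::comm_semiring_1 ext"
  assumes "homog n d x"
  shows "x = (\<Sum>K\<in>fkeys n. smult (x K) (bkey (fst K) (snd K)))"
proof
  fix L
  have "(\<Sum>K\<in>fkeys n. smult (x K) (bkey (fst K) (snd K))) L = (\<Sum>K\<in>fkeys n. if K = L then x K else 0)"
    unfolding sum_ext_apply by (intro sum.cong) (auto simp: bkey_def)
  also have "\<dots> = x L"
    using homogD[OF assms, of "fst L" "snd L"] by (auto simp: sum.delta fkeys_def mem_Times_iff)
  finally show "x L = (\<Sum>K\<in>fkeys n. smult (x K) (bkey (fst K) (snd K))) L" ..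
qed

lemma vect_expand:
  fixes w :: "'a::comm_semiring_1 vect"
  assumes "vin n w"
  shows "w l = (\<Sum>i<n. w i * bv i l)"
proof -
  have "(\<Sum>i<n. w i * bv i l) = (\<Sum>i<n. if i = l then w i else 0)"
    by (intro sum.cong) (auto simp: bv_def)
  then show ?thesis using assms by (auto simp: sum.delta vin_def)
qed

lemma endo_smult: "endo n f \<Longrightarrow> vin n v \<Longrightarrow> f (\<lambda>i. c * v i) = (\<lambda>i. c * f v i)"
  by (simp add: endo_def)

lemma endo_expand:
  fixes f :: "'a::comm_semiring_1 vect \<Rightarrow> 'a vect"
  assumes "endo n f" "vin n w"
  shows "f w l = (\<Sum>i<n. w i * f (bv i) l)"
proof -
  have "vin n (\<lambda>l. \<Sum>i<m. w i * bv i l) \<and> f (\<lambda>l. \<Sum>i<m. w i * bv i l) = (\<lambda>l. \<Sum>i<m. w i * f (bv i) l)" if "m \<le> n" for m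
    using that
  proof (induction m)
    case 0
    have z: "vin n (\<lambda>i. 0 :: 'a)" by (simp add: vin_def)
    \<comment> \<open>Homogeneity with scalar 0 gives f(0) = 0.\<close>
    show ?case using endo_smult[OF assms(1) z, of 0] z by simp
  next
    case (Suc m)
    let ?a = "\<lambda>l. \<Sum>i<m. w i * bv i l" and ?b = "\<lambda>l. w m * bv m l"
    have b: "vin n (bv m :: 'a vect)" using Suc.prems by (auto intro: vin_bv)
    then have vb: "vin n ?b" by (auto simp: vin_def)
    have fb: "f ?b = (\<lambda>l. w m * f (bv m) l)" by (rule endo_smult[OF assms(1) b])
    have e: "(\<lambda>l. \<Sum>i<Suc m. w i * bv i l) = ?a + ?b" by auto
    have "f (?a + ?b) = f ?a + f ?b" using assms(1) vb Suc unfolding endo_def by auto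
    then show ?case unfolding e using Suc vb fb by (auto simp: vin_def)
  qed
  moreover have "(\<lambda>l. \<Sum>i<n. w i * bv i l) = w"
    by (rule ext) (rule vect_expand[OF assms(2), symmetric])
  ultimately show ?thesis by fastforce
qed

lemma vec_expand:
  fixes w :: "'a::comm_semiring_1 vect"
  assumes "\<And>l. w l = (\<Sum>i<n. c i * g i l)"
  shows "vec w = (\<Sum>i<n. smult (c i) (vec (g i)))"
  using assms by (auto simp: fun_eq_iff sum_ext_apply vec_def)

text \<open>In a cancellative semiring, \<open>sim\<close> is equality after passing to the classical
  exterior algebra over the ring of differences.\<close>

definition sim :: "'a::comm_semiring_1 ext \<Rightarrow> 'a ext \<Rightarrow> bool" where
  "sim x y \<longleftrightarrow> x + flip y = y + flip x"

lemma sim_refl [simp]: "sim x x"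
  by (simp add: sim_def)

text \<open>The middle terms \<open>y + flip y\<close> have to be removed from both sides. This is
  the step that ties the classical identity to cancellative semirings.\<close>

lemma sim_trans [trans]:
  fixes x y z :: "'a::{comm_semiring_1,cancel_semigroup_add} ext"
  assumes "sim x y" "sim y z"
  shows "sim x z"
proof -
  have "(x + flip z) + (y + flip y) = (x + flip y) + (y + flip z)" by (simp only: ac_simps)
  also have "\<dots> = (y + flip x) + (z + flip y)" using assms by (simp only: sim_def)
  also have "\<dots> = (z + flip x) + (y + flip y)" by (simp only: ac_simps)
  finally show ?thesis unfolding sim_def by (simp only: add_right_cancel)
qed

lemma sim_add:
  assumes "sim x y" "sim x' y'"
  shows "sim (x + x') (y + y')"
proof -
  have "(x + x') + (flip y + flip y') = (x + flip y) + (x' + flip y')" by (simp only: ac_simps)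
  also have "\<dots> = (y + flip x) + (y' + flip x')" using assms by (simp only: sim_def)
  also have "\<dots> = (y + y') + (flip x + flip x')" by (simp only: ac_simps)
  finally show ?thesis unfolding sim_def flip_add .
qed

lemma sim_sum: "(\<And>i. i \<in> A \<Longrightarrow> sim (g i) (h i)) \<Longrightarrow> sim (\<Sum>i\<in>A. g i) (\<Sum>i\<in>A. h i)"
  by (induction A rule: infinite_finite_induct)
    (simp_all only: sum.infinite sum.empty sum.insert sim_refl sim_add insert_iff not_False_eq_True simp_thms)

lemma sim_smult: "sim x y \<Longrightarrow> sim (smult c x) (smult c y)"
  unfolding sim_def flip_smult smult_add[symmetric] by simp

lemma sim_flip: "sim x y \<Longrightarrow> sim (flip x) (flip y)"
  unfolding sim_def flip_flip by (simp only: ac_simps)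

lemma sim_funpow_flip: "sim x y \<Longrightarrow> sim ((flip ^^ j) x) ((flip ^^ j) y)"
  by (induction j) (auto intro: sim_flip)

lemma sim_wedge_right: "sim x y \<Longrightarrow> sim (wedge w x) (wedge w y)"
  unfolding sim_def wedge_flip_right[symmetric] wedge_add_right[symmetric] by simp

lemma sim_zero_left: "flip y = y \<Longrightarrow> sim 0 y"
  by (simp add: sim_def)

lemma vec_wedge_bkey:
  assumes "finite J"
  shows "(wedge (vec (bv i)) (bkey J p) :: 'a::comm_semiring_1 ext) = (if i \<in> J then 0 else bkey (insert i J) (p \<noteq> odd (ninv {i} J)))"
proof (rule ext, clarify)
  fix K r
  have "wedge (vec (bv i)) (bkey J p) (K, r)
    = (\<Sum>l\<in>K. if l = i then bkey J p (K - {l}, r \<noteq> odd (ninv {l} (K - {l}))) else 0 :: 'a)"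
    unfolding vec_wedge_apply by (intro sum.cong) (auto simp: bv_def)
  also have "\<dots> = (if finite K \<and> i \<in> K then bkey J p (K - {i}, r \<noteq> odd (ninv {i} (K - {i}))) else 0)"
    by (cases "finite K") simp_all
  also have "\<dots> = (if i \<in> J then 0 else bkey (insert i J) (p \<noteq> odd (ninv {i} J))) (K, r)"
  proof (cases "i \<notin> J \<and> K = insert i J")
    case True
    then have "K - {i} = J" by auto
    then show ?thesis using True assms by (auto simp: bkey_def)
  next
    case False
    then have "\<not> (i \<in> K \<and> K - {i} = J)" by auto
    then show ?thesis using False by (auto simp: bkey_def)
  qed
  finally show "(wedge (vec (bv i)) (bkey J p) :: 'a ext) (K, r) = (if i \<in> J then 0 else bkey (insert i J) (p \<noteq> odd (ninv {i} J))) (K, r)" .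
qed

text \<open>The coefficient of \<open>z^j\<close> in the product of \<open>w + z f(w)\<close> with
  the subset sums of \<open>x\<close>: the value at \<open>w\<close> wedge \<open>x\<close> that
  multiplicativity predicts.\<close>

definition esum_step :: "nat \<Rightarrow> ('a::comm_semiring_1 vect \<Rightarrow> 'a vect) \<Rightarrow> nat \<Rightarrow> 'a vect \<Rightarrow> 'a ext \<Rightarrow> 'a ext" where
  "esum_step n f j w x = wedge (vec w) (esum_lin n f j x)
     + (case j of 0 \<Rightarrow> 0 | Suc i \<Rightarrow> wedge (vec (f w)) (esum_lin n f i x))"

lemma esum_step_vect_expand:
  assumes "endo n f" "vin n w"
  shows "esum_step n f j w x = (\<Sum>i<n. smult (w i) (esum_step n f j (bv i) x))"
proof -
  have a: "vec w = (\<Sum>i<n. smult (w i) (vec (bv i)))"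
    by (rule vec_expand, rule vect_expand) fact
  have b: "vec (f w) = (\<Sum>i<n. smult (w i) (vec (f (bv i))))"
    by (rule vec_expand, rule endo_expand) fact+
  show ?thesis
    unfolding esum_step_def a b wedge_sum_left wedge_smult_left smult_add sum.distrib
    by (cases j) (simp_all only: nat.case smult_zero_right sum.neutral_const)
qed

lemma esum_step_ext_sum:
  "esum_step n f j w (\<Sum>K\<in>A. smult (c K) (g K)) = (\<Sum>K\<in>A. smult (c K) (esum_step n f j w (g K)))"
  unfolding esum_step_def esum_lin_sum esum_lin_smult wedge_sum_right wedge_smult_right smult_add sum.distrib
  by (cases j) (simp_all only: nat.case smult_zero_right sum.neutral_const)

text \<open>For \<open>i \<notin> J\<close> sorting \<open>bv i\<close> into place gives equality.
  For \<open>i \<in> J\<close> the wedge product is 0 while the predicted value is merely invariant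
  under \<open>flip\<close>; this is why the conclusion is \<open>sim\<close> and not
  equality.\<close>

lemma esum_lin_wedge_basis:
  assumes "i < n" "J \<subseteq> {..<n}"
  shows "sim (esum_lin n f j (wedge (vec (bv i)) (bkey J p))) (esum_step n f j (bv i) (bkey J p))"
proof -
  have fin: "finite J" using assms(2) finite_subset by blast
  have E: "esum_step n f j (bv i) (bkey J p) = flip_if p (esum f j (bv i # basis_list J))"
    unfolding esum_step_def esum_lin_bkey[OF assms(2)] esum.simps flip_if_add wedge_flip_if_right
    by (cases j) (simp_all add: flip_if_def)
  show ?thesis
  proof (cases "i \<in> J")
    case True
    then have "sim 0 (flip_if p (esum f j (bv i # basis_list J)))"
      using flip_esum_repeat[OF fin True, of f j] by (intro sim_zero_left) (simp add: flip_if_def del: esum.simps)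
    then show ?thesis unfolding E vec_wedge_bkey[OF fin] using True by simp
  next
    case False
    have "insert i J \<subseteq> {..<n}" using assms by auto
    moreover have "((p \<noteq> odd (ninv {i} J)) \<noteq> odd (ninv {i} J)) = p" by auto
    ultimately show ?thesis
      unfolding E vec_wedge_bkey[OF fin] using False
      by (simp only: esum_lin_bkey esum_basis_list_insert[OF fin False] flip_if_flip_if if_False sim_refl)
  qed
qed

lemma esum_lin_wedge:
  assumes "endo n f" "vin n w" "homog n d x"
  shows "sim (esum_lin n f j (wedge (vec w) x)) (esum_step n f j w x)"
proof -
  have w: "vec w = (\<Sum>i<n. smult (w i) (vec (bv i)))"
    by (rule vec_expand, rule vect_expand) fact
  have x: "wedge y x = (\<Sum>K\<in>fkeys n. smult (x K) (wedge y (bkey (fst K) (snd K))))" for y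
    by (subst ext_expand[OF assms(3)]) (simp only: wedge_sum_right wedge_smult_right)
  have "wedge (vec w) x = (\<Sum>i<n. \<Sum>K\<in>fkeys n. smult (w i) (smult (x K) (wedge (vec (bv i)) (bkey (fst K) (snd K)))))"
    unfolding w wedge_sum_left wedge_smult_left x[symmetric] smult_sum[symmetric] ..
  then have "esum_lin n f j (wedge (vec w) x) = (\<Sum>i<n. \<Sum>K\<in>fkeys n. smult (w i) (smult (x K) (esum_lin n f j (wedge (vec (bv i)) (bkey (fst K) (snd K))))))"
    by (simp only: esum_lin_sum esum_lin_smult)
  moreover have "esum_step n f j w x = (\<Sum>i<n. \<Sum>K\<in>fkeys n. smult (w i) (smult (x K) (esum_step n f j (bv i) (bkey (fst K) (snd K)))))"
    unfolding esum_step_vect_expand[OF assms(1,2)]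
    by (subst ext_expand[OF assms(3)]) (simp only: esum_step_ext_sum smult_sum)
  ultimately show ?thesis
    by (simp only:) (intro sim_sum sim_smult esum_lin_wedge_basis; auto simp: fkeys_def)
qed

lemma sum_triangle_swap:
  "(\<Sum>j\<le>k. \<Sum>i\<le>k - j. g i j) = (\<Sum>i\<le>k. \<Sum>j\<le>k - i. g i j)" for k :: nat
proof -
  have "(\<Sum>j\<le>k. \<Sum>i\<le>k - j. g i j) = (\<Sum>(j, i)\<in>(SIGMA j:{..k}. {..k - j}). g i j)"
    by (rule sum.Sigma) auto
  also have "\<dots> = (\<Sum>(i, j)\<in>(SIGMA i:{..k}. {..k - i}). g i j)"
    by (rule sum.reindex_bij_witness[of _ "\<lambda>(i, j). (j, i)" "\<lambda>(j, i). (i, j)"]) auto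
  also have "\<dots> = (\<Sum>i\<le>k. \<Sum>j\<le>k - i. g i j)"
    by (rule sum.Sigma[symmetric]) auto
  finally show ?thesis .
qed

text \<open>Equals \<open>Dbar\<close> in degrees at least 2. In degree 1 it carries the sign that
  \<open>rhs_coeff\<close> applies only after wedging with \<open>u\<close>.\<close>

definition esum_signed :: "nat \<Rightarrow> ('a::comm_semiring_1 vect \<Rightarrow> 'a vect) \<Rightarrow> nat \<Rightarrow> 'a ext \<Rightarrow> 'a ext" where
  "esum_signed n f j x = (flip ^^ j) (esum_lin n f j x)"

lemma esum_signed_sum: "esum_signed n f j (\<Sum>i\<in>A. g i) = (\<Sum>i\<in>A. esum_signed n f j (g i))"
  unfolding esum_signed_def esum_lin_sum funpow_flip_sum ..

lemma homog_esum_signed: "endo n f \<Longrightarrow> homog n d x \<Longrightarrow> homog n d (esum_signed n f j x)"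
  unfolding esum_signed_def by (simp add: homog_esum_lin)

lemma esum_signed_wedge:
  assumes "endo n f" "vin n w" "homog n d x"
  shows "sim (esum_signed n f j (wedge (vec w) x))
    (wedge (vec w) (esum_signed n f j x) + (case j of 0 \<Rightarrow> 0 | Suc i \<Rightarrow> flip (wedge (vec (f w)) (esum_signed n f i x))))"
proof -
  have "sim (esum_signed n f j (wedge (vec w) x)) ((flip ^^ j) (esum_step n f j w x))"
    unfolding esum_signed_def by (intro sim_funpow_flip esum_lin_wedge[OF assms])
  also have "(flip ^^ j) (esum_step n f j w x) = wedge (vec w) (esum_signed n f j x) + (case j of 0 \<Rightarrow> 0 | Suc i \<Rightarrow> flip (wedge (vec (f w)) (esum_signed n f i x)))"
    unfolding esum_step_def esum_signed_def funpow_flip_add wedge_funpow_flip_right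
    by (cases j) (simp_all only: nat.case funpow_flip_zero funpow.simps comp_apply id_apply wedge_funpow_flip_right)
  finally show ?thesis .
qed

text \<open>Induction over the factors of \<open>u\<close>. With G(z) the left-hand side for the
  remaining factors, multiplicativity turns a new factor into the sum over \<open>i\<close> of z^i
  (f^i(u) - z f^(i+1)(u)) wedge G(z), of which only u wedge G(z) remains.\<close>

lemma Dbar_HS_telescope:
  fixes f :: "'a::{comm_semiring_1,cancel_semigroup_add} vect \<Rightarrow> 'a vect"
  assumes f: "endo n f" and Y: "homog n e Y"
  shows "(\<And>u. u \<in> set us \<Longrightarrow> vin n u) \<Longrightarrow>
    sim (\<Sum>j\<le>k. esum_signed n f j (wedge (HS f (k - j) us) Y)) (wedge (wedge_list us) (esum_signed n f k Y))"
proof (induction us arbitrary: k)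
  case Nil
  \<comment> \<open>The empty product has no coefficient beyond \<open>z^0\<close>, so only
    \<open>j = k\<close> survives.\<close>
  have "(\<Sum>j\<le>k. esum_signed n f j (wedge (HS f (k - j) []) Y)) = (\<Sum>j\<le>k. if j = k then esum_signed n f j (wedge gone Y) else 0)"
    by (intro sum.cong refl) (auto simp: esum_signed_def)
  also have "\<dots> = esum_signed n f k (wedge gone Y)" by (simp add: sum.delta)
  finally show ?case
    using wedge_gone_left[of Y] wedge_gone_left[of "esum_signed n f k Y"] homog_finite[OF Y] homog_finite[OF homog_esum_signed[OF f Y]]
    by simp
next
  case (Cons u us)
  define X where "X m = wedge (HS f m us) Y" for m
  define G where "G m = (\<Sum>j\<le>m. esum_signed n f j (X (m - j)))" for m
  have hX: "homog n (length us + e) (X m)" for m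
    unfolding X_def using homog_HS[OF f, of us m] Cons.prems Y by (intro homog_wedge) auto
  have vu: "vin n ((f ^^ i) u)" for i using Cons.prems f by (simp add: vin_funpow)
  define A where "A i j m = wedge (vec ((f ^^ i) u)) (esum_signed n f j (X m))" for i j m
  \<comment> \<open>The part in which the quasi-inverse applies \<open>f\<close> to the new factor:
    the power of \<open>f\<close> goes up by one, the index \<open>j\<close> goes down by one, and
    the sign changes.\<close>
  define B where "B i j m = (case j of 0 \<Rightarrow> 0 | Suc j' \<Rightarrow> flip (A (Suc i) j' m))" for i j m
  have GA: "wedge (vec ((f ^^ i) u)) (G m) = (\<Sum>j\<le>m. A i j (m - j))" for i m
    unfolding G_def A_def wedge_sum_right ..
  have "sim (\<Sum>j\<le>k. esum_signed n f j (wedge (HS f (k - j) (u # us)) Y)) (\<Sum>j\<le>k. \<Sum>i\<le>k - j. A i j (k - j - i) + B i j (k - j - i))"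
  proof (rule sim_sum)
    fix j
    have "esum_signed n f j (wedge (HS f (k - j) (u # us)) Y) = (\<Sum>i\<le>k - j. esum_signed n f j (wedge (vec ((f ^^ i) u)) (X (k - j - i))))"
      by (simp only: HS.simps wedge_sum_left wedge_assoc X_def esum_signed_sum)
    moreover have "sim \<dots> (\<Sum>i\<le>k - j. A i j (k - j - i) + B i j (k - j - i))"
      unfolding A_def B_def funpow.simps comp_apply by (intro sim_sum esum_signed_wedge[OF f vu hX])
    ultimately show "sim (esum_signed n f j (wedge (HS f (k - j) (u # us)) Y)) (\<Sum>i\<le>k - j. A i j (k - j - i) + B i j (k - j - i))"
      by simp
  qed
  also have "sim \<dots> (wedge (vec u) (G k))"
  proof -
    have SA: "(\<Sum>j\<le>k. \<Sum>i\<le>k - j. A i j (k - j - i)) = (\<Sum>i\<le>k. wedge (vec ((f ^^ i) u)) (G (k - i)))"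
      unfolding GA by (subst sum_triangle_swap) (simp only: diff_commute)
    show ?thesis
    proof (cases k)
      case 0
      then show ?thesis by (simp add: A_def B_def G_def)
    next
      case (Suc m)
      \<comment> \<open>All terms of \<open>A\<close> with a positive power of \<open>f\<close> on
        the new factor. The terms of \<open>B\<close> add up to \<open>flip C\<close>, so the pair
        is invisible to \<open>sim\<close>.\<close>
      define C where "C = (\<Sum>i\<le>m. wedge (vec ((f ^^ Suc i) u)) (G (m - i)))"
      have a: "(\<Sum>j\<le>k. \<Sum>i\<le>k - j. A i j (k - j - i)) = wedge (vec u) (G k) + C"
        unfolding SA unfolding C_def Suc sum.atMost_Suc_shift by simp
      have "(\<Sum>j\<le>k. \<Sum>i\<le>k - j. B i j (k - j - i)) = (\<Sum>j\<le>m. \<Sum>i\<le>m - j. flip (A (Suc i) j (m - j - i)))"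
        unfolding Suc sum.atMost_Suc_shift by (simp add: B_def)
      also have "\<dots> = flip C"
        unfolding C_def GA flip_sum by (subst sum_triangle_swap) (simp only: diff_commute)
      finally have b: "(\<Sum>j\<le>k. \<Sum>i\<le>k - j. B i j (k - j - i)) = flip C" .
      show ?thesis
        unfolding sum.distrib a b sim_def flip_add flip_flip by (simp only: ac_simps)
    qed
  qed
  also have "sim \<dots> (wedge (vec u) (wedge (wedge_list us) (esum_signed n f k Y)))"
    unfolding G_def X_def using Cons by (intro sim_wedge_right Cons.IH) auto
  finally show ?case by (simp add: wedge_assoc)
qed

subsection \<open>The generic matrix\<close>

text \<open>Here \<open>u\<close> and \<open>v\<close> are the unprimed basis elements of
  \<open>I\<close> and \<open>J\<close>; primes are restored by \<open>flip_if\<close> in the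
  bilinear expansions.\<close>

definition lhs_basis :: "nat \<Rightarrow> ('a::comm_semiring_1 vect \<Rightarrow> 'a vect) \<Rightarrow> nat set \<Rightarrow> nat set \<Rightarrow> nat \<Rightarrow> 'a ext" where
  "lhs_basis n f I J k = (\<Sum>j\<le>k. esum_signed n f j (wedge (HS f (k - j) (basis_list I)) (bkey J False)))"

definition rhs_basis :: "('a::comm_semiring_1 vect \<Rightarrow> 'a vect) \<Rightarrow> nat set \<Rightarrow> nat set \<Rightarrow> nat \<Rightarrow> 'a ext" where
  "rhs_basis f I J k = wedge (bkey I False) ((flip ^^ k) (esum f k (basis_list J)))"

lemma wedge_list_basis_list:
  assumes "finite I"
  shows "wedge_list (basis_list I) = (bkey I False :: 'a::comm_semiring_1 ext)"
proof -
  have "wedge_list (map bv xs) = (bkey (set xs) False :: 'a ext)" if "sorted xs" "distinct xs" for xs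
    using that
  proof (induction xs)
    case (Cons i xs)
    have "{j \<in> set xs. j < i} = {}" using Cons.prems by auto
    then have "ninv {i} (set xs) = 0" unfolding ninv_singleton by simp
    then show ?case using Cons by (simp add: vec_wedge_bkey)
  qed (simp add: gone_eq_bkey)
  then show ?thesis using assms by (simp add: basis_list_def)
qed

lemma sim_lhs_basis_rhs_basis:
  fixes f :: "'a::{comm_semiring_1,cancel_semigroup_add} vect \<Rightarrow> 'a vect"
  assumes "endo n f" "I \<subseteq> {..<n}" "J \<subseteq> {..<n}"
  shows "sim (lhs_basis n f I J k) (rhs_basis f I J k)"
proof -
  have I: "finite I" using assms finite_subset by blast
  have T: "esum_signed n f k (bkey J False) = (flip ^^ k) (esum f k (basis_list J))"
    unfolding esum_signed_def esum_lin_bkey[OF assms(3)] by (simp add: flip_if_def)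
  show ?thesis
    unfolding lhs_basis_def rhs_basis_def wedge_list_basis_list[OF I, symmetric] T[symmetric]
    by (rule Dbar_HS_telescope[OF assms(1) homog_bkey[OF assms(3) refl] vin_basis_list[OF assms(2)]])
qed

lemma homog_lhs_basis:
  fixes f :: "'a::comm_semiring_1 vect \<Rightarrow> 'a vect"
  assumes "endo n f" "I \<subseteq> {..<n}" "J \<subseteq> {..<n}"
  shows "homog n (card I + card J) (lhs_basis n f I J k)"
  unfolding lhs_basis_def using assms
  by (intro homog_sum homog_esum_signed homog_wedge homog_bkey homog_HS_basis_list) auto

text \<open>The universal case: polynomials with natural number coefficients in the entries of a
  generic matrix, a monomial being a multiset of entries (row, column).\<close>

type_synonym gpoly = "(nat \<times> nat) multiset \<Rightarrow>\<^sub>0 nat"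

definition gvar :: "nat \<Rightarrow> nat \<Rightarrow> gpoly" where
  "gvar l j = Poly_Mapping.single {#(l, j)#} 1"

text \<open>Column \<open>j\<close> of the matrix is the image of \<open>bv j\<close>. Coordinates
  from \<open>n\<close> on are cut off so that values stay in V_n.\<close>

definition genf :: "nat \<Rightarrow> gpoly vect \<Rightarrow> gpoly vect" where
  "genf n v = (\<lambda>l. if l < n then \<Sum>j<n. v j * gvar l j else 0)"

lemma endo_genf: "endo n (genf n)"
  by (auto simp: endo_def vin_def genf_def fun_eq_iff sum.distrib algebra_simps sum_distrib_left)

lemma genf_bv:
  assumes "j < n"
  shows "genf n (bv j) l = (if l < n then gvar l j else 0)"
proof -
  have "(\<Sum>i<n. bv j i * gvar l i) = (\<Sum>i<n. if i = j then gvar l i else 0)"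
    by (intro sum.cong) (auto simp: bv_def)
  then show ?thesis using assms by (simp add: genf_def)
qed

text \<open>A monomial determines the key, sign included, at which it occurs. The bound
  \<open>C\<close> on its columns carries the induction: a variable from a new column then proves
  that \<open>f\<close> was applied to the new factor.\<close>

definition mono_det :: "nat set \<Rightarrow> gpoly ext \<Rightarrow> bool" where
  "mono_det C x \<longleftrightarrow>
     (\<forall>m K r. m \<in> Poly_Mapping.keys (x (K, r)) \<longrightarrow> snd ` set_mset m \<subseteq> C) \<and>
     (\<forall>m K r K' r'. m \<in> Poly_Mapping.keys (x (K, r)) \<longrightarrow> m \<in> Poly_Mapping.keys (x (K', r')) \<longrightarrow> K = K' \<and> r = r')"

lemma keys_sum_subset: "m \<in> Poly_Mapping.keys (\<Sum>i\<in>A. g i) \<Longrightarrow> \<exists>i\<in>A. m \<in> Poly_Mapping.keys (g i)"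
  for g :: "'b \<Rightarrow> gpoly"
proof (induction A rule: infinite_finite_induct)
  case (insert x F)
  then show ?case using Poly_Mapping.keys_add[of "g x" "sum g F"] by auto
qed auto

lemma keys_vec_bv_wedge:
  fixes x :: "gpoly ext"
  assumes "m \<in> Poly_Mapping.keys (wedge (vec (bv j)) x (K, r))"
  shows "j \<in> K \<and> m \<in> Poly_Mapping.keys (x (K - {j}, r \<noteq> odd (ninv {j} (K - {j}))))"
proof -
  obtain i where i: "i \<in> K" "m \<in> Poly_Mapping.keys (bv j i * x (K - {i}, r \<noteq> odd (ninv {i} (K - {i}))))"
    using keys_sum_subset[OF assms[unfolded vec_wedge_apply]] by blast
  then have "i = j" by (auto simp: bv_def split: if_splits)
  then show ?thesis using i by (simp add: bv_def)
qed

lemma keys_vec_genf_wedge: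
  assumes "j < n" "m \<in> Poly_Mapping.keys (wedge (vec (genf n (bv j))) x (K, r))"
  shows "\<exists>i\<in>K. \<exists>m'. m = add_mset (i, j) m' \<and> m' \<in> Poly_Mapping.keys (x (K - {i}, r \<noteq> odd (ninv {i} (K - {i}))))"
proof -
  obtain i where i: "i \<in> K" "m \<in> Poly_Mapping.keys (genf n (bv j) i * x (K - {i}, r \<noteq> odd (ninv {i} (K - {i}))))"
    using keys_sum_subset[OF assms(2)[unfolded vec_wedge_apply]] by blast
  then have "m \<in> Poly_Mapping.keys (gvar i j * x (K - {i}, r \<noteq> odd (ninv {i} (K - {i}))))"
    unfolding genf_bv[OF assms(1)] by (auto split: if_splits)
  then obtain a b where "m = a + b" "a \<in> Poly_Mapping.keys (gvar i j)" "b \<in> Poly_Mapping.keys (x (K - {i}, r \<noteq> odd (ninv {i} (K - {i}))))"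
    using Poly_Mapping.keys_mult by blast
  then show ?thesis using i(1) by (auto simp: gvar_def split: if_splits)
qed

text \<open>A monomial of the sum contains a variable of column \<open>j\<close> exactly when it
  stems from the second summand. That variable names the row \<open>i\<close> that was picked, and
  the rest of the monomial determines the remaining key and sign.\<close>

lemma mono_det_step:
  assumes x: "mono_det C x" and y: "mono_det C y" and j: "j \<notin> C" "j < n"
  shows "mono_det (insert j C) (wedge (vec (bv j)) x + wedge (vec (genf n (bv j))) y)"
proof -
  let ?z = "wedge (vec (bv j)) x + wedge (vec (genf n (bv j))) y"
  have z: "(j \<in> K \<and> m \<in> Poly_Mapping.keys (x (K - {j}, r \<noteq> odd (ninv {j} (K - {j}))))) \<or>
    (\<exists>i\<in>K. \<exists>m'. m = add_mset (i, j) m' \<and> m' \<in> Poly_Mapping.keys (y (K - {i}, r \<noteq> odd (ninv {i} (K - {i})))))"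
    if "m \<in> Poly_Mapping.keys (?z (K, r))" for m K r
    using that keys_vec_bv_wedge[of m j x K r] keys_vec_genf_wedge[OF j(2), of m y K r]
      Poly_Mapping.keys_add[of "wedge (vec (bv j)) x (K, r)" "wedge (vec (genf n (bv j))) y (K, r)"]
    by auto
  have cx: "snd ` set_mset m \<subseteq> C" if "m \<in> Poly_Mapping.keys (x (K, r))" for m K r
    using x that unfolding mono_det_def by blast
  have cy: "snd ` set_mset m \<subseteq> C" if "m \<in> Poly_Mapping.keys (y (K, r))" for m K r
    using y that unfolding mono_det_def by blast
  have ux: "K = K' \<and> r = r'" if "m \<in> Poly_Mapping.keys (x (K, r))" "m \<in> Poly_Mapping.keys (x (K', r'))" for m K r K' r'
    using x that unfolding mono_det_def by blast
  have uy: "K = K' \<and> r = r'" if "m \<in> Poly_Mapping.keys (y (K, r))" "m \<in> Poly_Mapping.keys (y (K', r'))" for m K r K' r'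
    using y that unfolding mono_det_def by blast
  have no: "(i, j) \<notin># m" if "snd ` set_mset m \<subseteq> C" for i m
  proof
    assume "(i, j) \<in># m"
    then have "snd (i, j) \<in> snd ` set_mset m" by (rule imageI)
    then show False using that j(1) by auto
  qed
  show ?thesis
    unfolding mono_det_def
  proof (rule conjI; intro allI impI)
    fix m K r assume "m \<in> Poly_Mapping.keys (?z (K, r))"
    from z[OF this] show "snd ` set_mset m \<subseteq> insert j C"
      using cx cy by fastforce
  next
    fix m K r K' r'
    assume m: "m \<in> Poly_Mapping.keys (?z (K, r))" "m \<in> Poly_Mapping.keys (?z (K', r'))"
    have same: "K = K' \<and> r = r'"
      if "i \<in> K" "i \<in> K'" "K - {i} = K' - {i} \<and> (r \<noteq> odd (ninv {i} (K - {i}))) = (r' \<noteq> odd (ninv {i} (K' - {i})))" for i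
    proof -
      have "K = K'" using that by (metis insert_Diff)
      then show ?thesis using that by auto
    qed
    consider "j \<in> K" "m \<in> Poly_Mapping.keys (x (K - {j}, r \<noteq> odd (ninv {j} (K - {j}))))"
        "j \<in> K'" "m \<in> Poly_Mapping.keys (x (K' - {j}, r' \<noteq> odd (ninv {j} (K' - {j}))))"
      | i m' where "snd ` set_mset m \<subseteq> C" "m = add_mset (i, j) m'"
      | i m' i' m'' where "i \<in> K" "m = add_mset (i, j) m'" "m' \<in> Poly_Mapping.keys (y (K - {i}, r \<noteq> odd (ninv {i} (K - {i}))))"
        "i' \<in> K'" "m = add_mset (i', j) m''" "m'' \<in> Poly_Mapping.keys (y (K' - {i'}, r' \<noteq> odd (ninv {i'} (K' - {i'}))))"
      using z[OF m(1)] z[OF m(2)] cx by metis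
    then show "K = K' \<and> r = r'"
    proof cases
      case 1
      then show ?thesis by (intro same[of j] ux) auto
    next
      case 2
      then show ?thesis using no[of m i] by auto
    next
      case 3
      \<comment> \<open>Otherwise the second variable of column \<open>j\<close> would sit inside
        \<open>m'\<close>, whose columns lie in \<open>C\<close>.\<close>
      have "i = i'"
      proof (rule ccontr)
        assume "i \<noteq> i'"
        then have "(i', j) \<in># m'" using 3 by (metis add_mset_remove_trivial_eq insert_noteq_member prod.inject)
        then show False using no[OF cy[OF 3(3)]] by blast
      qed
      then have "m' = m''" using 3 by simp
      then show ?thesis using 3 \<open>i = i'\<close> by (intro same[of i] uy) auto
    qed
  qed
qed

lemma mono_det_zero: "mono_det C 0"
  by (simp add: mono_det_def)

lemma mono_det_esum:
  "distinct js \<Longrightarrow> set js \<subseteq> {..<n} \<Longrightarrow> mono_det (set js) (esum (genf n) k (map bv js))"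
proof (induction js arbitrary: k)
  case Nil
  show ?case by (cases "k = 0") (auto simp: mono_det_def gone_def split: if_splits)
next
  case (Cons j js)
  have "mono_det (insert j (set js)) (wedge (vec (bv j)) (esum (genf n) k (map bv js))
    + wedge (vec (genf n (bv j))) (case k of 0 \<Rightarrow> 0 | Suc i \<Rightarrow> esum (genf n) i (map bv js)))"
    using Cons by (intro mono_det_step) (auto simp: mono_det_zero split: nat.split)
  then show ?case by (cases k) (simp_all del: plus_fun_apply)
qed

text \<open>Wedging with b_I on the left introduces no variables; it moves keys injectively and
  changes signs by a parity fixed by \<open>I\<close> and \<open>K\<close>. So the determination of
  keys by monomials passes from the subset sum to the right-hand side.\<close>

lemma rhs_basis_generic_disjoint:
  assumes "J \<subseteq> {..<n}" "m \<in> Poly_Mapping.keys (rhs_basis (genf n) I J k (K, False))"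
  shows "m \<notin> Poly_Mapping.keys (rhs_basis (genf n) I J k (K, True))"
proof -
  have "finite J" using assms finite_subset by blast
  then have det: "mono_det J (esum (genf n) k (basis_list J))"
    unfolding basis_list_def using mono_det_esum[of "sorted_list_of_set J" n k] assms(1) by simp
  have flip_if_app: "flip_if p x (L, r) = x (L, p \<noteq> r)" for p L r and x :: "gpoly ext"
    by (auto simp: flip_if_def)
  define s where "s = odd (ninv I (K - I))"
  have key: "m \<in> Poly_Mapping.keys (esum (genf n) k (basis_list J) (K - I, odd k \<noteq> (False \<noteq> (r \<noteq> s))))"
    if "m \<in> Poly_Mapping.keys (rhs_basis (genf n) I J k (K, r))" for r
  proof (cases "finite K \<and> I \<subseteq> K")
    case True
    then show ?thesis
      using that unfolding rhs_basis_def bkey_wedge_apply funpow_flip_eq_flip_if flip_if_app s_def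
      by (simp only: if_True simp_thms)
  next
    case False
    then show ?thesis
      using that unfolding rhs_basis_def bkey_wedge_apply
      by (simp only: if_False Poly_Mapping.keys_zero empty_iff)
  qed
  show ?thesis
  proof
    assume "m \<in> Poly_Mapping.keys (rhs_basis (genf n) I J k (K, True))"
    from key[OF this] key[OF assms(2)]
    have "(odd k \<noteq> (False \<noteq> (True \<noteq> s))) = (odd k \<noteq> (False \<noteq> (False \<noteq> s)))"
      using det unfolding mono_det_def by blast
    then show False by auto
  qed
qed

text \<open>A keywise description of elements \<open>x + neg x\<close>. In this form it passes
  through sums, scalars and semiring homomorphisms; \<open>quasi_in_qideal\<close> leads back to the
  ideal.\<close>

definition quasi :: "nat \<Rightarrow> 'a::zero ext \<Rightarrow> bool" where
  "quasi n d \<longleftrightarrow> flip d = d \<and> (\<forall>I p. d (I, p) \<noteq> 0 \<longrightarrow> I \<subseteq> {..<n} \<and> 2 \<le> card I)"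

definition surpasses :: "nat \<Rightarrow> 'a::comm_semiring_1 ext \<Rightarrow> 'a ext \<Rightarrow> bool" where
  "surpasses n x y \<longleftrightarrow> (\<exists>d. quasi n d \<and> x = y + d)"

text \<open>Since no monomial of the right-hand side occurs with both signs, the classical identity
  forces the left-hand side to dominate it coefficientwise.\<close>

lemma surpasses_generic:
  assumes "I \<subseteq> {..<n}" "J \<subseteq> {..<n}" "2 \<le> card I + card J"
  shows "surpasses n (lhs_basis n (genf n) I J k) (rhs_basis (genf n) I J k)"
proof -
  define L R where "L = lhs_basis n (genf n) I J k" and "R = rhs_basis (genf n) I J k"
  \<comment> \<open>Truncated subtraction of natural coefficients; \<open>ge\<close> makes it a true
    difference.\<close>
  define d where "d K = L K - R K" for K
  have sim: "L + flip R = R + flip L"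
    using sim_lhs_basis_rhs_basis[OF endo_genf assms(1,2), of k] by (simp only: sim_def L_def R_def)
  have eq: "Poly_Mapping.lookup (L (K, p)) m + Poly_Mapping.lookup (R (K, \<not> p)) m = Poly_Mapping.lookup (R (K, p)) m + Poly_Mapping.lookup (L (K, \<not> p)) m" for K p m
    using arg_cong[OF sim, of "\<lambda>x. Poly_Mapping.lookup (x (K, p)) m"] by (simp add: Poly_Mapping.lookup_add)
  have dis: "Poly_Mapping.lookup (R (K, p)) m = 0 \<or> Poly_Mapping.lookup (R (K, \<not> p)) m = 0" for K p m
  proof -
    have "Poly_Mapping.lookup (R (K, False)) m = 0 \<or> Poly_Mapping.lookup (R (K, True)) m = 0"
      using rhs_basis_generic_disjoint[OF assms(2), of m I k K] unfolding R_def in_keys_iff by blast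
    then show ?thesis by (cases p) auto
  qed
  \<comment> \<open>Either the coefficient of \<open>R\<close> at this sign is 0, or the one at the
    opposite sign is; then \<open>eq\<close> expresses that of \<open>L\<close> as that of
    \<open>R\<close> plus a natural number.\<close>
  have ge: "Poly_Mapping.lookup (R (K, p)) m \<le> Poly_Mapping.lookup (L (K, p)) m" for K p m
    using eq[of K p m] dis[of K p m] by linarith
  have Ld: "L = R + d"
  proof (rule ext, clarify)
    fix K p
    show "L (K, p) = (R + d) (K, p)"
      by (rule poly_mapping_eqI) (simp add: d_def Poly_Mapping.lookup_add minus_poly_mapping.rep_eq ge)
  qed
  have "flip d = d"
  proof (rule ext, clarify)
    fix K p
    have "Poly_Mapping.lookup (L (K, \<not> p)) m - Poly_Mapping.lookup (R (K, \<not> p)) m = Poly_Mapping.lookup (L (K, p)) m - Poly_Mapping.lookup (R (K, p)) m" for m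
      using eq[of K p m] ge[of K p m] ge[of K "\<not> p" m] by linarith
    then show "flip d (K, p) = d (K, p)"
      by (intro poly_mapping_eqI) (simp add: d_def minus_poly_mapping.rep_eq)
  qed
  moreover have "K \<subseteq> {..<n} \<and> 2 \<le> card K" if "d (K, p) \<noteq> 0" for K p
  proof -
    have "L (K, p) \<noteq> 0"
    proof
      assume "L (K, p) = 0"
      then have "d (K, p) = 0"
        unfolding d_def by (intro poly_mapping_eqI) (simp add: minus_poly_mapping.rep_eq)
      then show False using that by contradiction
    qed
    then show ?thesis
      using homogD[OF homog_lhs_basis[OF endo_genf assms(1,2), of k]] assms(3) unfolding L_def by metis
  qed
  ultimately show ?thesis unfolding surpasses_def quasi_def using Ld unfolding L_def R_def by blast
qed

subsection \<open>Specialisation\<close>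

definition gmon :: "(nat \<times> nat \<Rightarrow> 'a::comm_semiring_1) \<Rightarrow> (nat \<times> nat) multiset \<Rightarrow> 'a" where
  "gmon g m = prod_mset (image_mset g m)"

text \<open>Defined over every commutative semiring because \<open>of_nat\<close> is; integer
  coefficients would require negatives in the target.\<close>

definition geval :: "(nat \<times> nat \<Rightarrow> 'a::comm_semiring_1) \<Rightarrow> gpoly \<Rightarrow> 'a" where
  "geval g p = (\<Sum>m\<in>Poly_Mapping.keys p. of_nat (Poly_Mapping.lookup p m) * gmon g m)"

lemma geval_superset:
  assumes "finite A" "Poly_Mapping.keys p \<subseteq> A"
  shows "geval g p = (\<Sum>m\<in>A. of_nat (Poly_Mapping.lookup p m) * gmon g m)"
  unfolding geval_def using assms by (intro sum.mono_neutral_left) (auto simp: in_keys_iff)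

lemma geval_zero [simp]: "geval g 0 = 0"
  by (simp add: geval_def)

lemma geval_add: "geval g (p + q) = geval g p + geval g q"
proof -
  let ?A = "Poly_Mapping.keys p \<union> Poly_Mapping.keys q"
  have "geval g (p + q) = (\<Sum>m\<in>?A. of_nat (Poly_Mapping.lookup (p + q) m) * gmon g m)"
    using Poly_Mapping.keys_add[of p q] by (intro geval_superset) auto
  also have "\<dots> = geval g p + geval g q"
    by (simp add: geval_superset[of ?A p] geval_superset[of ?A q] Poly_Mapping.lookup_add
        algebra_simps sum.distrib)
  finally show ?thesis .
qed

lemma geval_sum: "geval g (\<Sum>i\<in>A. h i) = (\<Sum>i\<in>A. geval g (h i))"
  by (induction A rule: infinite_finite_induct) (auto simp: geval_add)

lemma geval_single: "geval g (Poly_Mapping.single m c) = of_nat c * gmon g m"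
  by (auto simp: geval_def)

lemma gpoly_expand:
  "p = (\<Sum>m\<in>Poly_Mapping.keys p. Poly_Mapping.single m (Poly_Mapping.lookup p m))" for p :: gpoly
proof (rule poly_mapping_eqI)
  fix k
  show "Poly_Mapping.lookup p k = Poly_Mapping.lookup (\<Sum>m\<in>Poly_Mapping.keys p. Poly_Mapping.single m (Poly_Mapping.lookup p m)) k"
    by (auto simp: Poly_Mapping.lookup_sum Poly_Mapping.lookup_single when_def in_keys_iff)
qed

lemma geval_mult: "geval g (p * q) = geval g p * geval g q"
proof -
  let ?s = "\<lambda>p m. Poly_Mapping.single m (Poly_Mapping.lookup p m) :: gpoly"
  have "p * q = (\<Sum>a\<in>Poly_Mapping.keys p. \<Sum>b\<in>Poly_Mapping.keys q. ?s p a * ?s q b)"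
    unfolding sum_product[symmetric] gpoly_expand[symmetric] ..
  also have "geval g \<dots> = (\<Sum>a\<in>Poly_Mapping.keys p. \<Sum>b\<in>Poly_Mapping.keys q.
      (of_nat (Poly_Mapping.lookup p a) * gmon g a) * (of_nat (Poly_Mapping.lookup q b) * gmon g b))"
    by (simp add: geval_sum mult_single geval_single gmon_def algebra_simps)
  also have "\<dots> = geval g p * geval g q"
    unfolding geval_def sum_product ..
  finally show ?thesis .
qed

lemma geval_one [simp]: "geval g 1 = 1"
  by (simp add: geval_single gmon_def flip: single_one)

lemma geval_gvar: "geval g (gvar l j) = g (l, j)"
  by (simp add: gvar_def geval_single gmon_def)

section \<open>Transport along semiring homomorphisms\<close>

locale semiring_hom =
  fixes h :: "'a::comm_semiring_1 \<Rightarrow> 'b::comm_semiring_1"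
  assumes hom_zero: "h 0 = 0" and hom_one: "h 1 = 1"
    and hom_add: "h (x + y) = h x + h y" and hom_mult: "h (x * y) = h x * h y"
begin

lemma hom_sum: "h (\<Sum>i\<in>A. g i) = (\<Sum>i\<in>A. h (g i))"
  by (induction A rule: infinite_finite_induct) (auto simp: hom_zero hom_add)

lemma hom_ext_add: "h \<circ> (x + y) = (h \<circ> x) + (h \<circ> y)"
  by (auto simp: fun_eq_iff hom_add)

lemma hom_ext_zero: "h \<circ> 0 = 0"
  by (auto simp: fun_eq_iff hom_zero)

lemma hom_ext_sum: "h \<circ> (\<Sum>i\<in>A. g i) = (\<Sum>i\<in>A. h \<circ> g i)"
  by (auto simp: fun_eq_iff sum_ext_apply hom_sum)

lemma hom_ext_flip: "h \<circ> flip x = flip (h \<circ> x)"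
  by (auto simp: fun_eq_iff)

lemma hom_ext_flip_if: "h \<circ> flip_if p x = flip_if p (h \<circ> x)"
  by (auto simp: flip_if_def hom_ext_flip)

lemma hom_ext_smult: "h \<circ> smult c x = smult (h c) (h \<circ> x)"
  by (auto simp: fun_eq_iff hom_mult)

lemma hom_ext_wedge: "h \<circ> wedge x y = wedge (h \<circ> x) (h \<circ> y)"
  by (auto simp: fun_eq_iff wedge_apply hom_sum hom_mult)

lemma hom_ext_vec: "h \<circ> vec w = vec (h \<circ> w)"
  by (auto simp: fun_eq_iff vec_def hom_zero)

lemma hom_ext_bkey: "h \<circ> bkey I p = bkey I p"
  by (auto simp: fun_eq_iff bkey_def hom_zero hom_one)

lemma hom_basis_list: "map ((\<circ>) h) (basis_list I) = basis_list I"
proof -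
  have "h \<circ> bv i = bv i" for i by (auto simp: fun_eq_iff bv_def hom_zero hom_one)
  then show ?thesis by (simp add: basis_list_def)
qed

context
  fixes n F f
  assumes F: "endo n F" and Ff: "\<And>w. vin n w \<Longrightarrow> h \<circ> F w = f (h \<circ> w)"
begin

lemma hom_esum: "(\<And>u. u \<in> set us \<Longrightarrow> vin n u) \<Longrightarrow> h \<circ> esum F j us = esum f j (map ((\<circ>) h) us)"
proof (induction us arbitrary: j)
  case Nil
  show ?case by (cases "j = 0") (simp_all add: gone_eq_bkey hom_ext_bkey hom_ext_zero hom_zero)
next
  case (Cons u us)
  have IH: "h \<circ> esum F i us = esum f i (map ((\<circ>) h) us)" for i
    by (rule Cons.IH) (rule Cons.prems, simp)
  have u: "h \<circ> F u = f (h \<circ> u)" using Cons.prems by (intro Ff) simp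
  show ?case
    by (cases j) (simp_all only: esum.simps list.map nat.case hom_ext_add hom_ext_wedge hom_ext_vec
        hom_ext_zero IH u)
qed

lemma hom_funpow: "vin n u \<Longrightarrow> h \<circ> (F ^^ i) u = (f ^^ i) (h \<circ> u)"
proof (induction i)
  case (Suc i)
  have "h \<circ> F ((F ^^ i) u) = f (h \<circ> (F ^^ i) u)"
    by (rule Ff) (rule vin_funpow[OF F Suc.prems])
  also have "\<dots> = f ((f ^^ i) (h \<circ> u))"
    using Suc.IH[OF Suc.prems] by (rule arg_cong)
  finally show ?case by (metis comp_apply funpow.simps(2))
qed simp

lemma hom_HS: "(\<And>u. u \<in> set us \<Longrightarrow> vin n u) \<Longrightarrow> h \<circ> HS F k us = HS f k (map ((\<circ>) h) us)"
proof (induction us arbitrary: k)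
  case Nil
  show ?case by (cases "k = 0") (simp_all add: gone_eq_bkey hom_ext_bkey hom_ext_zero hom_zero)
next
  case (Cons u us)
  have IH: "h \<circ> HS F i us = HS f i (map ((\<circ>) h) us)" for i
    by (rule Cons.IH) (rule Cons.prems, simp)
  have u: "h \<circ> (F ^^ i) u = (f ^^ i) (h \<circ> u)" for i using Cons.prems by (intro hom_funpow) simp
  show ?case
    by (simp only: HS.simps list.map hom_ext_sum hom_ext_wedge hom_ext_vec IH u)
qed

lemma hom_esum_basis_list: "I \<subseteq> {..<n} \<Longrightarrow> h \<circ> esum F j (basis_list I) = esum f j (basis_list I)"
  by (subst hom_esum) (auto simp only: hom_basis_list intro: vin_basis_list)

lemma hom_HS_basis_list: "I \<subseteq> {..<n} \<Longrightarrow> h \<circ> HS F j (basis_list I) = HS f j (basis_list I)"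
  by (subst hom_HS) (auto simp only: hom_basis_list intro: vin_basis_list)

lemma hom_funpow_flip: "h \<circ> (flip ^^ j) x = (flip ^^ j) (h \<circ> x)"
  unfolding funpow_flip_eq_flip_if by (rule hom_ext_flip_if)

lemma hom_esum_signed: "h \<circ> esum_signed n F j x = esum_signed n f j (h \<circ> x)"
  unfolding esum_signed_def esum_lin_def hom_funpow_flip hom_ext_sum hom_ext_smult hom_ext_flip_if
  by (intro arg_cong[where f = "flip ^^ j"] sum.cong refl) (auto simp: fkeys_def hom_esum_basis_list)

lemma hom_lhs_basis: "I \<subseteq> {..<n} \<Longrightarrow> h \<circ> lhs_basis n F I J k = lhs_basis n f I J k"
  unfolding lhs_basis_def by (simp only: hom_ext_sum hom_esum_signed hom_ext_wedge hom_ext_bkey hom_HS_basis_list)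

lemma hom_rhs_basis: "J \<subseteq> {..<n} \<Longrightarrow> h \<circ> rhs_basis F I J k = rhs_basis f I J k"
  unfolding rhs_basis_def by (simp only: hom_ext_wedge hom_ext_bkey hom_funpow_flip hom_esum_basis_list)

end

text \<open>Invariance under \<open>flip\<close> is an equation and the support can only shrink, so
  the image of a quasi-zero is again one.\<close>

lemma surpasses_hom: "surpasses n x y \<Longrightarrow> surpasses n (h \<circ> x) (h \<circ> y)"
proof -
  assume "surpasses n x y"
  then obtain d where d: "quasi n d" "x = y + d" unfolding surpasses_def by blast
  have "flip (h \<circ> d) = h \<circ> d" using d(1) unfolding quasi_def by (metis hom_ext_flip)
  moreover have "I \<subseteq> {..<n} \<and> 2 \<le> card I" if "(h \<circ> d) (I, p) \<noteq> 0" for I p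
  proof -
    have "d (I, p) \<noteq> 0" using that by (auto simp: hom_zero)
    then show ?thesis using d(1) unfolding quasi_def by blast
  qed
  ultimately have "quasi n (h \<circ> d)" unfolding quasi_def by blast
  then show ?thesis unfolding surpasses_def d(2) hom_ext_add by blast
qed

end

lemma surpasses_basis:
  assumes f: "endo n f" and "I \<subseteq> {..<n}" "J \<subseteq> {..<n}" "2 \<le> card I + card J"
  shows "surpasses n (lhs_basis n f I J k) (rhs_basis f I J k)"
proof -
  \<comment> \<open>The variable in row \<open>l\<close> and column \<open>j\<close> is sent to
    coordinate \<open>l\<close> of \<open>f (bv j)\<close>, so that the generic matrix becomes the
    matrix of \<open>f\<close>.\<close>
  define h where "h = geval (\<lambda>(l, j). f (bv j) l)"
  interpret semiring_hom h
    by unfold_locales (auto simp: h_def geval_add geval_mult)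
  have Ff: "h \<circ> genf n w = f (h \<circ> w)" if w: "vin n w" for w
  proof
    fix l
    have hw: "vin n (h \<circ> w)" using w by (auto simp: vin_def hom_zero)
    show "(h \<circ> genf n w) l = f (h \<circ> w) l"
    proof (cases "l < n")
      case True
      have "(h \<circ> genf n w) l = (\<Sum>i<n. h (w i) * h (gvar l i))"
        using True by (simp add: genf_def hom_sum hom_mult)
      also have "\<dots> = f (h \<circ> w) l"
        unfolding endo_expand[OF f hw] by (simp add: h_def geval_gvar)
      finally show ?thesis .
    next
      case False
      then show ?thesis using vin_endo[OF f hw] by (simp add: genf_def hom_zero vin_def)
    qed
  qed
  have "h \<circ> lhs_basis n (genf n) I J k = lhs_basis n f I J k" "h \<circ> rhs_basis (genf n) I J k = rhs_basis f I J k"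
    by (rule hom_lhs_basis[OF endo_genf Ff assms(2)], assumption, rule hom_rhs_basis[OF endo_genf Ff assms(3)])
  then show ?thesis
    using surpasses_hom[OF surpasses_generic[OF assms(2-4), of k]] by argo
qed

section \<open>Closure properties of domination up to quasi-zeros\<close>

lemma quasi_add: "quasi n c \<Longrightarrow> quasi n d \<Longrightarrow> quasi n (c + d)" for c :: "'a::comm_semiring_1 ext"
  unfolding quasi_def flip_add by (metis add_0 plus_fun_apply)

lemma surpasses_refl: "surpasses n x x"
  unfolding surpasses_def quasi_def by (rule exI[of _ 0]) simp

lemma surpasses_add:
  assumes "surpasses n x y" "surpasses n x' y'"
  shows "surpasses n (x + x') (y + y')"
proof -
  obtain d d' where "quasi n d" "x = y + d" "quasi n d'" "x' = y' + d'"
    using assms unfolding surpasses_def by blast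
  then have "quasi n (d + d')" "x + x' = (y + y') + (d + d')"
    by (simp_all only: quasi_add ac_simps)
  then show ?thesis unfolding surpasses_def by blast
qed

lemma surpasses_sum: "(\<And>i. i \<in> A \<Longrightarrow> surpasses n (g i) (h i)) \<Longrightarrow> surpasses n (\<Sum>i\<in>A. g i) (\<Sum>i\<in>A. h i)"
  by (induction A rule: infinite_finite_induct)
    (simp_all only: sum.infinite sum.empty sum.insert surpasses_refl surpasses_add insert_iff not_False_eq_True simp_thms)

lemma surpasses_smult:
  assumes "surpasses n x y" shows "surpasses n (smult c x) (smult c y)"
proof -
  obtain d where d: "quasi n d" "x = y + d" using assms unfolding surpasses_def by blast
  have "quasi n (smult c d)"
    using d(1) unfolding quasi_def flip_smult by (metis mult_zero_right smult_apply)
  then show ?thesis unfolding surpasses_def d(2) smult_add by blast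
qed

lemma surpasses_flip_if:
  assumes "surpasses n x y" shows "surpasses n (flip_if p x) (flip_if p y)"
proof -
  obtain d where d: "quasi n d" "x = y + d" using assms unfolding surpasses_def by blast
  then have "flip_if p x = flip_if p y + d" by (auto simp: flip_if_def flip_add quasi_def)
  then show ?thesis using d unfolding surpasses_def by blast
qed

lemma quasi_in_qideal:
  assumes "quasi n d"
  shows "d \<in> qideal n"
proof -
  \<comment> \<open>The unprimed half of \<open>d\<close>; by invariance under \<open>flip\<close>
    its negation is the primed half.\<close>
  define x where "x = (\<lambda>(I, p). if p then 0 else d (I, p))"
  have fl: "d (I, \<not> p) = d (I, p)" for I p
    using assms unfolding quasi_def by (metis flip_apply)
  have nz: "I \<subseteq> {..<n} \<and> 2 \<le> card I" if "d (I, p) \<noteq> 0" for I p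
    using assms that unfolding quasi_def by blast
  have "gwf n x" "high x"
    using nz unfolding gwf_def high_def gkeys_def x_def by (auto split: if_splits) fastforce+
  moreover have "x + neg x = d"
  proof (rule ext, clarify)
    fix I p
    show "(x + neg x) (I, p) = d (I, p)"
    proof (cases "2 \<le> card I")
      case True
      then show ?thesis using fl[of I p] by (cases p) (auto simp: x_def neg_def)
    next
      case False
      then have "d (I, q) = 0" for q using nz[of I q] by blast
      then show ?thesis by (simp add: x_def neg_def)
    qed
  qed
  ultimately have "d \<in> qgens n" unfolding qgens_def by blast
  \<comment> \<open>Elements enter the ideal as two-sided multiples of generators; here both
    multipliers are the unit.\<close>
  moreover have "gwf n (gone :: 'a ext)" by (auto simp: gwf_def gone_def gkeys_def)
  ultimately have "wedge (wedge gone d) gone \<in> qideal n" by (intro qgen)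
  moreover have "d (K, p) = 0" if "infinite K" for K p
    using nz[of K p] that finite_subset by auto
  ultimately show ?thesis by (simp add: wedge_gone_left wedge_gone_right)
qed

lemma surpasses_imp_succeq: "surpasses n x y \<Longrightarrow> succeq n x y"
  unfolding surpasses_def succeq_def using quasi_in_qideal by blast

subsection \<open>Bilinear expansion\<close>

definition pkeys :: "nat \<Rightarrow> (nat set \<times> bool) set" where
  "pkeys n = gkeys n - {({}, False)}"

lemma finite_gkeys: "finite (gkeys n)"
  by (rule finite_subset[of _ "fkeys n"]) (auto simp: gkeys_def fkeys_def)

lemma finite_pkeys [simp]: "finite (pkeys n)"
  by (simp add: pkeys_def finite_gkeys)

lemma pkeysD:
  assumes "K \<in> pkeys n"
  shows "fst K \<subseteq> {..<n}" "1 \<le> card (fst K)" "snd K \<Longrightarrow> 2 \<le> card (fst K)"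
proof -
  show s: "fst K \<subseteq> {..<n}" and p: "snd K \<Longrightarrow> 2 \<le> card (fst K)"
    using assms by (auto simp: pkeys_def gkeys_def)
  have "fst K \<noteq> {}"
  proof
    assume e: "fst K = {}"
    then have "\<not> snd K" using p by auto
    then show False using e assms by (cases K) (auto simp: pkeys_def)
  qed
  moreover have "finite (fst K)" using s finite_subset by blast
  ultimately show "1 \<le> card (fst K)" by (simp add: Suc_le_eq card_gt_0_iff)
qed

lemma pkeys_expand:
  fixes x :: "'a::comm_semiring_1 ext"
  assumes "gwf n x" "x ({}, False) = 0"
  shows "x = (\<Sum>K\<in>pkeys n. smult (x K) (flip_if (snd K) (bkey (fst K) False)))"
proof
  fix L
  have "(\<Sum>K\<in>pkeys n. smult (x K) (flip_if (snd K) (bkey (fst K) False))) L = (\<Sum>K\<in>pkeys n. if K = L then x K else 0)"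
    unfolding sum_ext_apply
    by (intro sum.cong refl; cases L) (auto simp: bkey_def flip_if_def)
  also have "\<dots> = x L"
    using assms by (cases L) (auto simp: pkeys_def gwf_def finite_gkeys)
  finally show "x L = (\<Sum>K\<in>pkeys n. smult (x K) (flip_if (snd K) (bkey (fst K) False))) L" ..
qed

lemma Dk_expand:
  fixes f :: "'a::comm_semiring_1 vect \<Rightarrow> 'a vect"
  assumes f: "endo n f" and "u ({}, False) = 0"
  shows "Dk n f m u = (\<Sum>K\<in>pkeys n. smult (u K) (flip_if (snd K) (HS f m (basis_list (fst K)))))"
proof -
  have "Dk n f m u = (\<Sum>K\<in>pkeys n. smult (u K) (negp (snd K) (HS f m (basis_list (fst K)))))"
    unfolding Dk_def pkeys_def using assms by (intro sum.mono_neutral_right) (auto simp: finite_gkeys)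
  also have "\<dots> = (\<Sum>K\<in>pkeys n. smult (u K) (flip_if (snd K) (HS f m (basis_list (fst K)))))"
  proof (intro sum.cong refl)
    fix K assume K: "K \<in> pkeys n"
    have "neg (HS f m (basis_list (fst K))) = flip (HS f m (basis_list (fst K)))" if "snd K"
      using homog_HS_basis_list[OF f pkeysD(1)[OF K]] pkeysD(3)[OF K that] by (rule neg_homog)
    then show "smult (u K) (negp (snd K) (HS f m (basis_list (fst K)))) = smult (u K) (flip_if (snd K) (HS f m (basis_list (fst K))))"
      by (auto simp: negp_def flip_if_def)
  qed
  finally show ?thesis .
qed

lemma Dbar_add: "Dbar n f j (x + y) = Dbar n f j x + Dbar n f j y"
  unfolding Dbar_def plus_fun_apply smult_add_left sum.distrib ..

lemma Dbar_zero: "Dbar n f j 0 = 0"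
  by (auto simp: Dbar_def fun_eq_iff sum_ext_apply)

lemma Dbar_smult: "Dbar n f j (smult c x) = smult c (Dbar n f j x)"
  unfolding Dbar_def smult_sum smult_smult smult_apply ..

lemma Dbar_sum: "Dbar n f j (\<Sum>i\<in>A. g i) = (\<Sum>i\<in>A. Dbar n f j (g i))"
  by (induction A rule: infinite_finite_induct)
    (simp_all only: sum.infinite sum.empty sum.insert Dbar_add Dbar_zero not_False_eq_True)

lemma esum_lin_flip: "esum_lin n f j (flip x) = flip (esum_lin n f j x)"
  unfolding esum_lin_def flip_sum flip_smult
  by (rule sum.reindex_bij_witness[of _ "\<lambda>(I, p). (I, \<not> p)" "\<lambda>(I, p). (I, \<not> p)"])
    (auto simp: fkeys_def flip_if_def)

lemma esum_signed_flip_if: "esum_signed n f j (flip_if p x) = flip_if p (esum_signed n f j x)"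
  unfolding esum_signed_def by (auto simp: flip_if_def esum_lin_flip funpow_swap1)

lemma flip_if_sum: "flip_if p (\<Sum>i\<in>A. g i) = (\<Sum>i\<in>A. flip_if p (g i))"
  by (simp add: flip_if_def flip_sum)

lemma smult_flip_if: "smult c (flip_if p x) = flip_if p (smult c x)"
  by (simp add: flip_if_def flip_smult)

text \<open>Both arguments have positive degree, so their product lies in degrees at least 2:
  \<open>Dbar\<close> discards nothing and agrees with \<open>esum_signed\<close>.\<close>

lemma lhs_coeff_expand:
  fixes f :: "'a::comm_semiring_1 vect \<Rightarrow> 'a vect"
  assumes f: "endo n f" and u: "u ({}, False) = 0" and v: "gwf n v" "v ({}, False) = 0"
  shows "lhs_coeff n f u v k = (\<Sum>K\<in>pkeys n. \<Sum>L\<in>pkeys n.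
    smult (u K) (smult (v L) (flip_if (snd K) (flip_if (snd L) (lhs_basis n f (fst K) (fst L) k)))))"
proof -
  have Dbar: "Dbar n f j (wedge (Dk n f m u) v) = (\<Sum>K\<in>pkeys n. \<Sum>L\<in>pkeys n.
    smult (u K) (smult (v L) (flip_if (snd K) (flip_if (snd L) (esum_signed n f j (wedge (HS f m (basis_list (fst K))) (bkey (fst L) False)))))))" for j m
  proof -
    have "wedge (Dk n f m u) v = wedge (\<Sum>K\<in>pkeys n. smult (u K) (flip_if (snd K) (HS f m (basis_list (fst K)))))
      (\<Sum>L\<in>pkeys n. smult (v L) (flip_if (snd L) (bkey (fst L) False)))"
      unfolding Dk_expand[where u = u, OF f u] using pkeys_expand[OF v] by (rule arg_cong)
    also have "\<dots> = (\<Sum>K\<in>pkeys n. \<Sum>L\<in>pkeys n. smult (u K) (smult (v L)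
        (flip_if (snd K) (flip_if (snd L) (wedge (HS f m (basis_list (fst K))) (bkey (fst L) False))))))"
      unfolding wedge_sum_left wedge_smult_left wedge_flip_if_left
      unfolding wedge_sum_right wedge_smult_right wedge_flip_if_right smult_sum smult_flip_if flip_if_sum ..
    finally have e: "wedge (Dk n f m u) v = \<dots>" .
    have "Dbar n f j (flip_if (snd K) (flip_if (snd L) (wedge (HS f m (basis_list (fst K))) (bkey (fst L) False))))
      = flip_if (snd K) (flip_if (snd L) (esum_signed n f j (wedge (HS f m (basis_list (fst K))) (bkey (fst L) False))))"
      if K: "K \<in> pkeys n" and L: "L \<in> pkeys n" for K L
    proof -
      have h: "homog n (card (fst K) + card (fst L)) (wedge (HS f m (basis_list (fst K))) (bkey (fst L) False))"
        using pkeysD(1)[OF K] pkeysD(1)[OF L] f by (intro homog_wedge homog_bkey homog_HS_basis_list) auto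
      have "2 \<le> card (fst K) + card (fst L)" using pkeysD(2)[OF K] pkeysD(2)[OF L] by simp
      then show ?thesis
        by (subst Dbar_eq_esum_lin[OF f]) (auto simp: h simp flip: esum_signed_flip_if esum_signed_def)
    qed
    then show ?thesis unfolding e Dbar_sum Dbar_smult by (intro sum.cong refl) simp
  qed
  have "lhs_coeff n f u v k = (\<Sum>j\<le>k. \<Sum>K\<in>pkeys n. \<Sum>L\<in>pkeys n.
    smult (u K) (smult (v L) (flip_if (snd K) (flip_if (snd L) (esum_signed n f j (wedge (HS f (k - j) (basis_list (fst K))) (bkey (fst L) False)))))))"
    unfolding lhs_coeff_def Dbar ..
  also have "\<dots> = (\<Sum>K\<in>pkeys n. \<Sum>j\<le>k. \<Sum>L\<in>pkeys n.
    smult (u K) (smult (v L) (flip_if (snd K) (flip_if (snd L) (esum_signed n f j (wedge (HS f (k - j) (basis_list (fst K))) (bkey (fst L) False)))))))"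
    by (rule sum.swap)
  also have "\<dots> = (\<Sum>K\<in>pkeys n. \<Sum>L\<in>pkeys n. \<Sum>j\<le>k.
    smult (u K) (smult (v L) (flip_if (snd K) (flip_if (snd L) (esum_signed n f j (wedge (HS f (k - j) (basis_list (fst K))) (bkey (fst L) False)))))))"
    by (intro sum.cong refl sum.swap)
  finally show ?thesis unfolding lhs_basis_def flip_if_sum smult_sum .
qed

lemma neg_high: "high x \<Longrightarrow> neg x = flip x"
  unfolding neg_def high_def by (auto simp: fun_eq_iff)

text \<open>Absorbs the separate treatment of the degree 1 part of \<open>v\<close>. The subset sums
  of a one-element list are v_1, f(v_1) and 0 from \<open>z^2\<close> on, and after wedging with
  \<open>u\<close> the map \<open>neg\<close> acts as \<open>flip\<close>.\<close>

lemma rhs_coeff_eq: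
  fixes f :: "'a::comm_semiring_1 vect \<Rightarrow> 'a vect"
  assumes f: "endo n f" and u: "gwf n u" "u ({}, False) = 0" and v: "gwf n v" "v ({}, False) = 0"
  shows "rhs_coeff n f u v k
    = wedge u (\<Sum>L\<in>pkeys n. smult (v L) (flip_if (snd L) ((flip ^^ k) (esum f k (basis_list (fst L))))))"
proof -
  define P1 P2 where "P1 = (\<lambda>j. ({j}, False)) ` {..<n}" and "P2 = {L \<in> gkeys n. 2 \<le> card (fst L)}"
  define t where "t L = smult (v L) (flip_if (snd L) ((flip ^^ k) (esum f k (basis_list (fst L)))))" for L
  define b where "b k = (\<Sum>j<n. smult (v ({j}, False)) (esum f k [bv j]))" for k
  have P: "pkeys n = P2 \<union> P1"
  proof
    show "pkeys n \<subseteq> P2 \<union> P1"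
    proof
      fix L assume L: "L \<in> pkeys n"
      show "L \<in> P2 \<union> P1"
      proof (cases "2 \<le> card (fst L)")
        case True
        then show ?thesis using L by (simp add: P2_def pkeys_def)
      next
        case False
        then have "card (fst L) = 1" "\<not> snd L" using pkeysD(2,3)[OF L] by auto
        then obtain j where "L = ({j}, False)" by (cases L) (auto simp: card_1_singleton_iff)
        then show ?thesis using pkeysD(1)[OF L] by (auto simp: P1_def)
      qed
    qed
    show "P2 \<union> P1 \<subseteq> pkeys n"
      by (auto simp: P1_def P2_def pkeys_def gkeys_def)
  qed
  have t1: "t ({j}, False) = (flip ^^ k) (smult (v ({j}, False)) (esum f k [bv j]))" for j
    unfolding t_def funpow_flip_eq_flip_if smult_flip_if by (simp add: basis_list_def flip_if_def)
  have "(\<Sum>L\<in>pkeys n. t L) = (\<Sum>L\<in>P2. t L) + (\<Sum>L\<in>P1. t L)"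
    unfolding P by (rule sum.union_disjoint) (auto simp: P1_def P2_def finite_gkeys)
  also have "(\<Sum>L\<in>P1. t L) = (flip ^^ k) (b k)"
    unfolding P1_def b_def funpow_flip_sum
    by (subst sum.reindex) (auto simp: inj_on_def t1 simp del: esum.simps)
  also have "(\<Sum>L\<in>P2. t L) = Dbar n f k v"
    unfolding Dbar_def P2_def[symmetric]
  proof (intro sum.cong refl)
    fix L assume "L \<in> P2"
    then have L: "fst L \<subseteq> {..<n}" "2 \<le> card (fst L)" by (auto simp: P2_def gkeys_def)
    show "t L = smult (v L) (negp (snd L) (Qbar f k (basis_list (fst L))))"
      unfolding t_def negp_Qbar_basis_list[OF f L] ..
  qed
  finally have sum_t: "wedge u (\<Sum>L\<in>pkeys n. t L) = wedge u (Dbar n f k v) + (flip ^^ k) (wedge u (b k))"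
    by (simp only: wedge_add_right wedge_funpow_flip_right)
  have vv: "vin n (vpart v)" using v(1) by (auto simp: vin_def vpart_def gwf_def gkeys_def)
  have vg: "wedge (vec w) gone = vec w" for w :: "'a vect"
    by (rule wedge_gone_right) (simp add: vec_def)
  have b0: "b 0 = vec (vpart v)"
    unfolding b_def using vec_expand[where g = bv, OF vect_expand[OF vv]]
    by (simp add: vg vpart_def)
  have b1: "b 1 = vec (f (vpart v))"
    unfolding b_def using vec_expand[where g = "\<lambda>i. f (bv i)", OF endo_expand[OF f vv]]
    by (simp add: vg vpart_def)
  have b2: "b (Suc (Suc i)) = 0" for i
    by (simp add: b_def del: plus_fun_apply zero_fun_apply)
  have hi: "high (wedge u (vec w))" for w
    unfolding high_def
  proof (intro allI impI)
    fix K r assume K: "card (K :: nat set) < 2"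
    show "wedge u (vec w) (K, r) = 0"
    proof (cases "finite K")
      case True
      have "u (I, p) * vec w (K - I, q) = 0" if "I \<subseteq> K" for I p q
      proof (cases "I = {}")
        case True
        \<comment> \<open>The unprimed unit coefficient vanishes by assumption, the primed one
          because \<open>u\<close> is well-formed.\<close>
        then have "u (I, p) = 0" using u by (cases p) (auto simp: gwf_def gkeys_def)
        then show ?thesis by simp
      next
        case False
        then have "0 < card I" using \<open>finite K\<close> that finite_subset by (auto simp: card_gt_0_iff)
        then have "card (K - I) \<noteq> 1"
          using K \<open>finite K\<close> that by (simp add: card_Diff_subset finite_subset)
        then show ?thesis by (simp add: vec_def)
      qed
      then show ?thesis unfolding wedge_apply by (intro sum.neutral ballI) auto
    qed (simp add: wedge_apply)
  qed
  consider "k = 0" | "k = 1" | i where "k = Suc (Suc i)"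
    by (metis One_nat_def not0_implies_Suc)
  then have "rhs_coeff n f u v k = wedge u (Dbar n f k v) + (flip ^^ k) (wedge u (b k))"
  proof cases
    case 1
    then show ?thesis
      unfolding rhs_coeff_def by (simp add: b0 del: plus_fun_apply)
  next
    case 2
    then show ?thesis
      unfolding rhs_coeff_def by (simp add: b1[unfolded One_nat_def] neg_high[OF hi] del: plus_fun_apply)
  next
    case 3
    then show ?thesis
      unfolding rhs_coeff_def by (simp add: b2 del: plus_fun_apply zero_fun_apply)
  qed
  then show ?thesis unfolding sum_t[symmetric] t_def .
qed

lemma rhs_coeff_expand:
  assumes f: "endo n f" and u: "gwf n u" "u ({}, False) = 0" and v: "gwf n v" "v ({}, False) = 0"
  shows "rhs_coeff n f u v k = (\<Sum>K\<in>pkeys n. \<Sum>L\<in>pkeys n.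
    smult (u K) (smult (v L) (flip_if (snd K) (flip_if (snd L) (rhs_basis f (fst K) (fst L) k)))))"
proof -
  have "rhs_coeff n f u v k = wedge (\<Sum>K\<in>pkeys n. smult (u K) (flip_if (snd K) (bkey (fst K) False)))
    (\<Sum>L\<in>pkeys n. smult (v L) (flip_if (snd L) ((flip ^^ k) (esum f k (basis_list (fst L))))))"
    unfolding rhs_coeff_eq[OF assms]
    using pkeys_expand[OF u] by (rule arg_cong[where f = "\<lambda>x. wedge x _"])
  also have "\<dots> = (\<Sum>K\<in>pkeys n. \<Sum>L\<in>pkeys n.
    smult (u K) (smult (v L) (flip_if (snd K) (flip_if (snd L) (rhs_basis f (fst K) (fst L) k)))))"
    unfolding wedge_sum_left wedge_smult_left wedge_flip_if_left rhs_basis_def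
    unfolding wedge_sum_right wedge_smult_right wedge_flip_if_right smult_sum smult_flip_if flip_if_sum ..
  finally show ?thesis .
qed

theorem theorem3p5:
  fixes n :: nat and f :: "'a::comm_semiring_1 vect \<Rightarrow> 'a vect" and u v :: "'a ext"
  assumes "2 \<le> n"
    and "endo n f"
    and "gwf n u" and "u ({}, False) = 0"
    and "gwf n v" and "v ({}, False) = 0"
  shows "\<forall>k. succeq n (lhs_coeff n f u v k) (rhs_coeff n f u v k)"
proof
  fix k
  \<comment> \<open>Keys in \<open>pkeys n\<close> have nonempty index sets, which supplies the
    degree bound 2 for the product.\<close>
  have "surpasses n (lhs_basis n f (fst K) (fst L) k) (rhs_basis f (fst K) (fst L) k)"
    if "K \<in> pkeys n" "L \<in> pkeys n" for K L
    using pkeysD(1,2)[OF that(1)] pkeysD(1,2)[OF that(2)] assms(2) by (intro surpasses_basis) auto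
  then have "surpasses n (lhs_coeff n f u v k) (rhs_coeff n f u v k)"
    unfolding lhs_coeff_expand[where u = u, OF assms(2,4-6)] rhs_coeff_expand[OF assms(2-6)]
    by (intro surpasses_sum surpasses_smult surpasses_flip_if)
  then show "succeq n (lhs_coeff n f u v k) (rhs_coeff n f u v k)"
    by (rule surpasses_imp_succeq)
qed

end
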